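(* Let $k$ be a positive integer, $N$ a positive integer divisible by $4$, and $\frac{p}{q}$ (with $\gcd(p,q)=1$, $q>0$) a rational number which is $\Gamma_0(N)$-equivalent to the cusp $i\infty$ and satisfies $p^2\equiv 1 \pmod q$. Let $g\in S_{k+\frac12}(\Gamma_0(N))$ have Fourier expansion \[g(z)=\sum_{n\geq 1} b_n n^{\frac{k}{2}-\frac14}e(nz),\] with $b_1\neq 0$ and $b_j\in\mathbb R$ for all $j$. Then the additively twisted $L$-function $L_{p/q}(s,g)$ has infinitely many zeros on the critical line $\mathrm{Re}\, s=\frac12$.
   Context: $e(z)=e^{2\pi i z}$. $S_{k+\frac12}(\Gamma_0(N))$ ($4\mid N$) is the space of holomorphic cusp forms of half-integral weight $k+\frac12$ for $\Gamma_0(N)$ in the sense of Shimura: holomorphic functions on the upper half plane, vanishing at all cusps, with $g\left(\frac{az+b}{cz+d}\right)=\left(\frac{c}{d}\right)^{2k+1}\epsilon_d^{-1-2k}(cz+d)^{k+\frac12}g(z)$ for all $\begin{pmatrix}a&b\\c&d\end{pmatrix}\in\Gamma_0(N)$, where $\sqrt{z}$ is taken with $-\pi/2<\arg\sqrt z\le \pi/2$, $\epsilon_d=1$ if $d\equiv1\pmod 4$ and $\epsilon_d=i$ if $d\equiv 3\pmod 4$, and $\left(\frac{c}{d}\right)$ is Shimura's extension of the Jacobi symbol. A rational $p/q$ is $\Gamma_0(N)$-equivalent to $i\infty$ if $p/q=\gamma(i\infty)$ for some $\gamma\in\Gamma_0(N)$. The additively twisted $L$-function is $L_{p/q}(s,g)=\sum_{n\geq1}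 b_n e(np/q)n^{-s}$ (continued analytically to $\mathbb C$). *)

theory Defs
  imports "HOL-Complex_Analysis.Complex_Analysis" "HOL-Number_Theory.Number_Theory"
begin

definition e_fun :: "complex \<Rightarrow> complex" where
  "e_fun z = exp (2 * of_real pi * \<i> * z)"

definition upper_half_plane :: "complex set" where
  "upper_half_plane = {z. Im z > 0}"

definition SL2Z :: "(int^2^2) set" where
  "SL2Z = {A. det A = 1}"

definition Gamma0 :: "nat \<Rightarrow> (int^2^2) set" where
  "Gamma0 N = {A \<in> SL2Z. int N dvd A $ 2 $ 1}"

text \<open>The denominator \<open>c z + d\<close> and the action of a matrix with rows \<open>(a, b)\<close>, \<open>(c, d)\<close>.\<close>

definition auto_denom :: "int^2^2 \<Rightarrow> complex \<Rightarrow> complex" where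
  "auto_denom A z = of_int (A $ 2 $ 1) * z + of_int (A $ 2 $ 2)"

definition moebius :: "int^2^2 \<Rightarrow> complex \<Rightarrow> complex" where
  "moebius A z = (of_int (A $ 1 $ 1) * z + of_int (A $ 1 $ 2)) / auto_denom A z"

text \<open>A rational (hence finite) number is \<open>\<Gamma>\<^sub>0(N)\<close>-equivalent to \<open>i\<infinity>\<close> if it is the image
  \<open>a / c\<close> of \<open>i\<infinity>\<close> under some matrix; the images with \<open>c = 0\<close> are \<open>i\<infinity>\<close> itself.\<close>

definition equiv_infinity :: "nat \<Rightarrow> real \<Rightarrow> bool" where
  "equiv_infinity N r \<longleftrightarrow>
     (\<exists>A\<in>Gamma0 N. A $ 2 $ 1 \<noteq> 0 \<and> r = of_int (A $ 1 $ 1) / of_int (A $ 2 $ 1))"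

text \<open>Shimura's extension of the Jacobi symbol, for odd \<open>d\<close> of either sign. It is the Jacobi symbol
  \<open>(c / \<bar>d\<bar>)\<close>, with an additional sign when both \<open>c\<close> and \<open>d\<close> are negative. In particular it
  vanishes when \<open>c\<close> and \<open>d\<close> are not coprime, and \<open>(0 / \<plusminus>1) = 1\<close> (empty product).\<close>

definition shimura_symbol :: "int \<Rightarrow> int \<Rightarrow> int" where
  "shimura_symbol c d =
     (if c < 0 \<and> d < 0 then -1 else 1) *
     (\<Prod>p\<in>#prime_factorization (nat \<bar>d\<bar>). Legendre c (int p))"

text \<open>Only odd \<open>d\<close> matter, so the second case is \<open>d \<equiv> 3 (mod 4)\<close>.\<close>

definition eps :: "int \<Rightarrow> complex" where
  "eps d = (if d mod 4 = 1 then 1 else \<i>)"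

text \<open>The space \<open>S\<^bsub>k+1/2\<^esub>(\<Gamma>\<^sub>0(N))\<close>, for \<open>4 dvd N\<close>. The power \<open>w\<^bsup>k+1/2\<^esup>\<close> is the \<open>(2k+1)\<close>-st power of the
  square root of \<open>w\<close> with argument in \<open>(-\<pi>/2, \<pi>/2]\<close>, which is the branch of \<^const>\<open>csqrt\<close>.
  Every cusp is the image of \<open>i\<infinity>\<close> under some element of the full modular group, and vanishing there
  means that the form, slashed by that element, tends to 0 as \<open>Im z \<rightarrow> \<infinity>\<close> (uniformly in
  \<open>Re z\<close>); the choice of the root of unity in the slash operator is immaterial for this.\<close>

definition half_integral_cusp_forms :: "nat \<Rightarrow> nat \<Rightarrow> (complex \<Rightarrow> complex) set" where
  "half_integral_cusp_forms k N = {g.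
     g holomorphic_on upper_half_plane \<and>
     (\<forall>A\<in>Gamma0 N. \<forall>z\<in>upper_half_plane.
        g (moebius A z) =
          of_int (shimura_symbol (A $ 2 $ 1) (A $ 2 $ 2)) ^ (2 * k + 1) *
          eps (A $ 2 $ 2) powi (- 1 - 2 * int k) *
          csqrt (auto_denom A z) ^ (2 * k + 1) * g z) \<and>
     (\<forall>A\<in>SL2Z.
        ((\<lambda>z. g (moebius A z) / csqrt (auto_denom A z) ^ (2 * k + 1)) \<longlongrightarrow> 0)
          (filtercomap Im at_top))}"

definition is_twisted_L :: "(nat \<Rightarrow> complex) \<Rightarrow> real \<Rightarrow> (complex \<Rightarrow> complex) \<Rightarrow> bool" where
  "is_twisted_L b r L \<longleftrightarrow>
     L holomorphic_on UNIV \<and>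
     (\<exists>\<sigma>::real. \<forall>s. Re s > \<sigma> \<longrightarrow>
        ((\<lambda>n. b n * e_fun (of_nat n * of_real r) * of_nat n powr (- s)) has_sum L s) {1..})"

lemma is_twisted_L_unique:
  assumes "is_twisted_L b r L" "is_twisted_L b r L'"
  shows "L = L'"
proof
  fix s
  obtain \<sigma> where \<sigma>: "\<And>s. Re s > \<sigma> \<Longrightarrow>
      ((\<lambda>n. b n * e_fun (of_nat n * of_real r) * of_nat n powr (- s)) has_sum L s) {1..}"
    using assms(1) unfolding is_twisted_L_def by blast
  obtain \<sigma>' where \<sigma>': "\<And>s. Re s > \<sigma>' \<Longrightarrow>
      ((\<lambda>n. b n * e_fun (of_nat n * of_real r) * of_nat n powr (- s)) has_sum L' s) {1..}"
    using assms(2) unfolding is_twisted_L_def by blast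
  define H where "H = {z. Re z > max \<sigma> \<sigma>'}"
  have "of_real (max \<sigma> \<sigma>' + 1) \<in> H" by (simp add: H_def max_def)
  then have ne: "H \<noteq> {}" by blast
  have op: "open H" unfolding H_def by (rule open_halfspace_Re_gt)
  have eq: "L z = L' z" if "z \<in> H" for z
    using that by (intro has_sum_unique[OF \<sigma> \<sigma>']) (simp_all add: H_def)
  have hol: "L holomorphic_on UNIV" "L' holomorphic_on UNIV"
    using assms unfolding is_twisted_L_def by blast+
  show "L s = L' s"
    by (rule analytic_continuation_open[OF op open_UNIV ne connected_UNIV subset_UNIV hol eq UNIV_I])
qed

text \<open>The entire continuation of the Dirichlet series \<open>\<Sum> b\<^sub>n e(n r) n\<^bsup>-s\<^esup>\<close>.\<close>

definition twisted_L :: "(nat \<Rightarrow> complex) \<Rightarrow> real \<Rightarrow> complex \<Rightarrow> complex" where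
  "twisted_L b r = (THE L. is_twisted_L b r L)"

end

theory Submission
  imports Defs "HOL-Probability.Probability"
begin

text \<open>Since \<open>p\<^sup>2 \<equiv> 1 (mod q)\<close>, a matrix with rows \<open>(p, \<beta>)\<close>, \<open>(q, p)\<close> lies in \<open>\<Gamma>\<^sub>0(N)\<close>. As the coefficients
  are real, it follows that \<open>h(w) = \<eta> exp((k + 1/2) w / 2) g(p/q + i e\<^sup>w/q)\<close>, for a suitable constant \<open>\<eta>\<close>
  of modulus 1, satisfies \<open>h(-u) = cnj (h(u))\<close> for real \<open>u\<close>. So its Fourier transform \<open>H(t)\<close>, which is
  \<open>L\<^bsub>p/q\<^esub>(1/2 + i t)\<close> up to a factor without zeros, is real. If \<open>L\<^bsub>p/q\<^esub>\<close> had finitely many zeros on the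
  critical line, then \<open>H\<close> would have constant sign for large \<open>t\<close>, and Fourier inversion on the
  line \<open>Im w = \<theta>\<close> would give \<open>|h(u + i \<theta>)| \<le> |h(i \<theta>)| + O(1)\<close> for all \<open>u\<close>, uniformly for \<open>\<theta> < \<pi>/2\<close>.
  As \<open>\<theta> \<rightarrow> \<pi>/2\<close>, the argument of \<open>g\<close> in \<open>h(i \<theta>)\<close> tends to the cusp \<open>(p - 1)/q\<close>, where \<open>g\<close> decays, so
  that \<open>h\<close> would be bounded near the line \<open>Im w = \<pi>/2\<close>. But \<open>|g|\<close> is unbounded on a sequence of
  \<open>\<Gamma>\<^sub>0(N)\<close>-equivalent points that tends to the real line.\<close>

no_notation fps_nth (infixl "$" 75)

subsection \<open>Functions of rapid decay on a strip\<close>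

text \<open>Once \<open>H\<close> has constant sign, taking absolute values in the inversion
  integral costs only a bounded amount, so every abscissa \<open>u\<close> is dominated by
  \<open>u = 0\<close> and only the curve \<open>pt (\<i> * \<theta>)\<close> has to be controlled.
  Its end point is a cusp that may be inequivalent to infinity, which is why \<open>g\<close> is
  studied through its slashes by all of \<open>SL2Z\<close>. The inversion carries a Gaussian
  factor, which makes every interchange of integrals absolutely convergent. The inequality is proved
  with constants independent of the width of the Gaussian, and the width tends to infinity last.
  Half-integral weight brings a multiplier and a choice of square root. They have to be followed
  exactly only in \<open>G_reflect\<close>, where they collapse into one constant of modulus 1;
  elsewhere moduli and even powers suffice. The logarithmic coordinate turns the functional equation
  into \<open>w \<mapsto> - w\<close>, and a rotation of the path of integration into a change of
  \<open>Im w\<close>.\<close>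

definition strip :: "complex set" where
  "strip = {w. \<bar>Im w\<bar> < pi / 2}"

lemma integrable_exp_minus_abs: "integrable lborel (\<lambda>u::real. exp (- \<bar>u\<bar>))"
proof (rule Bochner_Integration.integrable_bound)
  show "integrable lborel (\<lambda>u::real. 2 * inverse (1 + u\<^sup>2))"
    using integrable_inverse_1_plus_square
    by (simp add: set_integrable_def)
  have "exp (-\<bar>u\<bar>) \<le> 2 * inverse (1 + u\<^sup>2)" for u :: real
  proof -
    have "1 + \<bar>u\<bar> + \<bar>u\<bar>\<^sup>2 / 2 \<le> exp \<bar>u\<bar>"
      by (rule exp_lower_Taylor_quadratic) simp
    then have "1 + u\<^sup>2 \<le> 2 * exp \<bar>u\<bar>" by auto
    moreover have "1 + u\<^sup>2 > 0"
      by (simp add: add_pos_nonneg)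
    ultimately show ?thesis
      by (simp add: exp_minus field_simps)
  qed
  then show "AE u in lborel. norm (exp (-\<bar>u\<bar>)) \<le> norm (2 * inverse (1 + u\<^sup>2) :: real)"
    by (intro AE_I2) (simp add: abs_of_nonneg)
qed auto

lemma integrable_exp_decay:
  fixes f :: "real \<Rightarrow> complex"
  assumes "f \<in> borel_measurable borel" and "\<And>u. norm (f u) \<le> C * exp (- \<bar>u\<bar>)"
  shows "integrable lborel f"
proof (rule Bochner_Integration.integrable_bound)
  show "integrable lborel (\<lambda>u::real. C * exp (- \<bar>u\<bar>))"
    using integrable_exp_minus_abs by simp
  show "AE u in lborel. norm (f u) \<le> norm (C * exp (- \<bar>u\<bar>))"
    using assms(2) by (intro AE_I2) (smt (verit, best) norm_ge_zero real_norm_def)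
qed (use assms in simp)

lemma holomorphic_measurable_line:
  assumes "f holomorphic_on strip" and "\<bar>\<theta>\<bar> < pi / 2"
  shows "(\<lambda>u. f (complex_of_real u + \<i> * \<theta>)) \<in> borel_measurable borel"
    and "continuous_on UNIV (\<lambda>u. f (complex_of_real u + \<i> * \<theta>))"
proof -
  have "continuous_on strip f"
    using assms(1) by (rule holomorphic_on_imp_continuous_on)
  then show "continuous_on UNIV (\<lambda>u. f (complex_of_real u + \<i> * \<theta>))"
    by (rule continuous_on_compose2) (use assms(2) in \<open>auto intro!: continuous_intros simp: strip_def\<close>)
  then show "(\<lambda>u. f (complex_of_real u + \<i> * \<theta>)) \<in> borel_measurable borel"
    by (rule borel_measurable_continuous_onI)
qed

lemma strip_eq: "strip = {w. Im w < pi / 2} \<inter> {w. Im w > - (pi / 2)}"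
  by (auto simp: strip_def)

lemma open_strip: "open strip"
  unfolding strip_eq by (intro open_Int open_halfspace_Im_lt open_halfspace_Im_gt)

lemma convex_strip: "convex strip"
  unfolding strip_eq by (intro convex_Int convex_halfspace_Im_lt convex_halfspace_Im_gt)

text \<open>With a primitive \<open>\<Psi>\<close> on the convex strip, the truncated integrals
  along the two lines are differences of values of \<open>\<Psi>\<close>. They differ by two
  vertical increments at \<open>n\<close> and \<open>- n\<close>, which the decay of
  \<open>\<Phi>\<close> sends to 0.\<close>

lemma integral_shift_strip:
  assumes hol: "\<Phi> holomorphic_on strip" and \<theta>: "\<bar>\<theta>\<bar> < pi / 2"
    and bound: "\<And>w. \<bar>Im w\<bar> \<le> \<bar>\<theta>\<bar> \<Longrightarrow> norm (\<Phi> w) \<le> C * exp (- \<bar>Re w\<bar>)"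
  shows "(LINT u|lborel. \<Phi> (complex_of_real u + \<i> * \<theta>)) = (LINT u|lborel. \<Phi> (complex_of_real u))"
proof -
  obtain \<Psi> where \<Psi>: "\<And>w. w \<in> strip \<Longrightarrow> (\<Psi> has_field_derivative \<Phi> w) (at w within strip)"
    using holomorphic_convex_primitive'[OF convex_strip open_strip hol] by blast
  have \<Psi>': "(\<Psi> has_field_derivative \<Phi> w) (at w)" if "w \<in> strip" for w
    using \<Psi>[OF that] that by (simp add: at_within_open[OF _ open_strip])
  have FTC: "(LINT u|lborel. indicator {-real n..real n} u *\<^sub>R \<Phi> (complex_of_real u + \<i> * t)) =
      \<Psi> (of_nat n + \<i> * t) - \<Psi> (- of_nat n + \<i> * t)" if t: "\<bar>t\<bar> < pi / 2" for n t
  proof -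
    have cont: "continuous_on {-real n..real n} (\<lambda>u. \<Phi> (complex_of_real u + \<i> * t))"
      using holomorphic_measurable_line(2)[OF hol t] by (rule continuous_on_subset) simp
    have "((\<lambda>u. \<Psi> (complex_of_real u + \<i> * t)) has_vector_derivative \<Phi> (complex_of_real u + \<i> * t))
        (at u within {-real n..real n})" for u
    proof -
      have 1: "((\<lambda>u. complex_of_real u + \<i> * t) has_vector_derivative 1) (at u within {-real n..real n})"
        by (auto intro!: derivative_eq_intros)
      have 2: "(\<Psi> has_field_derivative \<Phi> (complex_of_real u + \<i> * t)) (at (complex_of_real u + \<i> * t))"
        by (rule \<Psi>') (use t in \<open>simp add: strip_def\<close>)
      from field_vector_diff_chain_within[OF 1 DERIV_subset[OF 2 subset_UNIV]] show ?thesis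
        by (simp add: o_def)
    qed
    from integral_FTC_Icc[OF _ this cont] show ?thesis
      by (simp add: )
  qed
  have lim: "(\<lambda>n. LINT u|lborel. indicator {-real n..real n} u *\<^sub>R \<Phi> (complex_of_real u + \<i> * t))
      \<longlonglongrightarrow> (LINT u|lborel. \<Phi> (complex_of_real u + \<i> * t))" if t: "\<bar>t\<bar> \<le> \<bar>\<theta>\<bar>" for t
  proof (rule integral_dominated_convergence)
    have [measurable]: "(\<lambda>u. \<Phi> (complex_of_real u + \<i> * t)) \<in> borel_measurable borel"
      using t \<theta> by (intro holomorphic_measurable_line(1)[OF hol]) simp
    show "(\<lambda>u. \<Phi> (complex_of_real u + \<i> * t)) \<in> borel_measurable lborel"
      "\<And>n. (\<lambda>u. indicator {-real n..real n} u *\<^sub>R \<Phi> (complex_of_real u + \<i> * t)) \<in> borel_measurable lborel"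
      by measurable
    show "integrable lborel (\<lambda>u::real. C * exp (- \<bar>u\<bar>))"
      using integrable_exp_minus_abs by simp
    have nb: "norm (\<Phi> (complex_of_real u + \<i> * t)) \<le> C * exp (- \<bar>u\<bar>)" for u
      using bound[of "complex_of_real u + \<i> * t"] t by simp
    have "0 \<le> C"
      using order_trans[OF norm_ge_zero nb[of 0]] by simp
    then show "AE u in lborel. norm (indicator {-real n..real n} u *\<^sub>R \<Phi> (complex_of_real u + \<i> * t)) \<le> C * exp (- \<bar>u\<bar>)" for n
      using nb by (intro AE_I2) (auto simp: indicator_def)
    show "AE u in lborel. (\<lambda>n. indicator {-real n..real n} u *\<^sub>R \<Phi> (complex_of_real u + \<i> * t)) \<longlonglongrightarrow> \<Phi> (complex_of_real u + \<i> * t)"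
    proof (intro AE_I2 tendsto_eventually)
      fix u :: real
      have "eventually (\<lambda>n. real n \<ge> \<bar>u\<bar>) sequentially"
        using eventually_ge_at_top[of "nat \<lceil>\<bar>u\<bar>\<rceil>"] by eventually_elim linarith
      then show "\<forall>\<^sub>F n in sequentially. indicator {-real n..real n} u *\<^sub>R \<Phi> (complex_of_real u + \<i> * t) = \<Phi> (complex_of_real u + \<i> * t)"
        by eventually_elim (auto simp: indicator_def)
    qed
  qed
  have vert: "norm (\<Psi> (a + \<i> * \<theta>) - \<Psi> a) \<le> C * exp (- \<bar>Re a\<bar>) * \<bar>\<theta>\<bar>" if "Im a = 0" for a :: complex
  proof -
    define S where "S = closed_segment a (a + \<i> * \<theta>)"
    have S: "Re z = Re a \<and> \<bar>Im z\<bar> \<le> \<bar>\<theta>\<bar>" if z: "z \<in> S" for z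
    proof -
      obtain v where v: "0 \<le> v" "v \<le> 1" "z = (1 - v) *\<^sub>R a + v *\<^sub>R (a + \<i> * \<theta>)"
        using z by (auto simp: S_def in_segment)
      have "Im z = v * \<theta>" using v(3) \<open>Im a = 0\<close> by simp
      moreover have "Re z = Re a" using v(3) by (simp add: algebra_simps)
      ultimately show ?thesis using v(1,2) by (simp add: abs_mult mult_left_le_one_le)
    qed
    have "norm (\<Psi> (a + \<i> * \<theta>) - \<Psi> a) \<le> C * exp (- \<bar>Re a\<bar>) * norm (a + \<i> * \<theta> - a)"
    proof (rule field_differentiable_bound)
      show "convex S" by (simp add: S_def)
      show "(\<Psi> has_field_derivative \<Phi> z) (at z within S)" if "z \<in> S" for z
        by (rule DERIV_subset[OF \<Psi>' subset_UNIV]) (use S[OF that] \<theta> in \<open>simp add: strip_def\<close>)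
      show "norm (\<Phi> z) \<le> C * exp (- \<bar>Re a\<bar>)" if "z \<in> S" for z
        using bound[of z] S[OF that] by simp
    qed (auto simp: S_def)
    then show ?thesis by (simp add: norm_mult)
  qed
  have e0: "(\<lambda>n. C * exp (- real n) * \<bar>\<theta>\<bar>) \<longlonglongrightarrow> 0"
    by real_asymp
  have d0: "(\<lambda>n. \<Psi> (of_nat n + \<i> * \<theta>) - \<Psi> (of_nat n)) \<longlonglongrightarrow> 0"
    by (rule Lim_null_comparison[OF _ e0]) (use vert[of "of_nat _"] in auto)
  have d1: "(\<lambda>n. \<Psi> (- of_nat n + \<i> * \<theta>) - \<Psi> (- of_nat n)) \<longlonglongrightarrow> 0"
    by (rule Lim_null_comparison[OF _ e0]) (use vert[of "- of_nat _"] in auto)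
  have "(\<lambda>n. (\<Psi> (of_nat n + \<i> * \<theta>) - \<Psi> (- of_nat n + \<i> * \<theta>)) - (\<Psi> (of_nat n) - \<Psi> (- of_nat n))) \<longlonglongrightarrow> 0"
    using tendsto_diff[OF d0 d1] by (simp add: algebra_simps)
  moreover have "(\<lambda>n. (\<Psi> (of_nat n + \<i> * \<theta>) - \<Psi> (- of_nat n + \<i> * \<theta>)) - (\<Psi> (of_nat n) - \<Psi> (- of_nat n)))
      \<longlonglongrightarrow> (LINT u|lborel. \<Phi> (complex_of_real u + \<i> * \<theta>)) - (LINT u|lborel. \<Phi> (complex_of_real u))"
    using tendsto_diff[OF lim[of \<theta>] lim[of 0]] FTC[OF \<theta>] FTC[of 0] by simp
  ultimately show ?thesis
    using LIMSEQ_unique by fastforce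
qed

text \<open>Faster than every exponential, but uniform only on closed substrips: the constant may
  blow up as \<theta> approaches \<pi>/2. For the function of interest it does, by
  \<open>G_unbounded\<close>.\<close>

definition rapid_decay :: "(complex \<Rightarrow> complex) \<Rightarrow> bool" where
  "rapid_decay h \<longleftrightarrow>
     (\<forall>\<theta> A. 0 \<le> \<theta> \<and> \<theta> < pi / 2 \<longrightarrow> (\<exists>C. \<forall>w. \<bar>Im w\<bar> \<le> \<theta> \<longrightarrow> norm (h w) \<le> C * exp (- A * \<bar>Re w\<bar>)))"

lemma rapid_decayE:
  assumes "rapid_decay h" and "\<bar>\<theta>\<bar> < pi / 2"
  obtains C where "C \<ge> 0" and "\<And>w. \<bar>Im w\<bar> \<le> \<bar>\<theta>\<bar> \<Longrightarrow> norm (h w) \<le> C * exp (- A * \<bar>Re w\<bar>)"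
proof -
  obtain C where C: "\<And>w. \<bar>Im w\<bar> \<le> \<bar>\<theta>\<bar> \<Longrightarrow> norm (h w) \<le> C * exp (- A * \<bar>Re w\<bar>)"
    using assms unfolding rapid_decay_def by (metis abs_ge_zero)
  have "0 \<le> C" using order_trans[OF norm_ge_zero C[of 0]] by simp
  with C that show thesis by blast
qed

text \<open>In terms of the usual Mellin transform, the variable of integration is the logarithm.\<close>

definition mellin :: "(complex \<Rightarrow> complex) \<Rightarrow> complex \<Rightarrow> complex" where
  "mellin h s = (LINT u|lborel. h (complex_of_real u) * exp (s * complex_of_real u))"

text \<open>Decay at rate \<open>A + R\<close> absorbs the factor
  \<open>exp (R * \<bar>Re w\<bar>)\<close>, and the bounded imaginary part costs at most
  \<open>exp (R * pi)\<close>. Uniformity in \<open>norm s \<le> R\<close> is what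
  \<open>mellin_entire\<close> relies on.\<close>

lemma rapid_decay_mult_exp:
  assumes "rapid_decay h" and "\<bar>\<theta>\<bar> < pi / 2" and "R \<ge> 0"
  obtains C where "C \<ge> 0"
    and "\<And>w s. \<bar>Im w\<bar> \<le> \<bar>\<theta>\<bar> \<Longrightarrow> norm s \<le> R \<Longrightarrow> norm (h w * exp (s * w)) \<le> C * exp (- A * \<bar>Re w\<bar>)"
proof -
  obtain C where C: "C \<ge> 0" "\<And>w. \<bar>Im w\<bar> \<le> \<bar>\<theta>\<bar> \<Longrightarrow> norm (h w) \<le> C * exp (- (A + R) * \<bar>Re w\<bar>)"
    using rapid_decayE[OF assms(1,2)] by metis
  show thesis
  proof (rule that[of "C * exp (R * pi)"])
    show "0 \<le> C * exp (R * pi)" using C by simp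
    fix w s :: complex assume w: "\<bar>Im w\<bar> \<le> \<bar>\<theta>\<bar>" and s: "norm s \<le> R"
    have "Re (s * w) \<le> norm (s * w)" by (rule complex_Re_le_cmod)
    also have "\<dots> \<le> R * (\<bar>Re w\<bar> + \<bar>Im w\<bar>)"
      unfolding norm_mult by (intro mult_mono s cmod_le) (use assms in auto)
    also have "\<dots> \<le> R * \<bar>Re w\<bar> + R * pi"
      using w assms(2,3) pi_gt_zero by (auto simp: distrib_left intro!: mult_left_mono)
    finally have "norm (exp (s * w)) \<le> exp (R * \<bar>Re w\<bar> + R * pi)" by simp
    then have "norm (h w * exp (s * w)) \<le> C * exp (- (A + R) * \<bar>Re w\<bar>) * exp (R * \<bar>Re w\<bar> + R * pi)"
      unfolding norm_mult using C w by (intro mult_mono) auto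
    also have "\<dots> = C * exp (R * pi) * exp (- A * \<bar>Re w\<bar>)"
      by (simp add: exp_add[symmetric] algebra_simps)
    finally show "norm (h w * exp (s * w)) \<le> C * exp (R * pi) * exp (- A * \<bar>Re w\<bar>)" .
  qed
qed

section \<open>The Mellin transform: change of line and analyticity\<close>

lemma mellin_integrable:
  assumes hol: "h holomorphic_on strip" and dec: "rapid_decay h" and \<theta>: "\<bar>\<theta>\<bar> < pi / 2"
  shows "integrable lborel (\<lambda>u. h (complex_of_real u + \<i> * \<theta>) * exp (s * (complex_of_real u + \<i> * \<theta>)))"
proof -
  obtain C where C: "C \<ge> 0" "\<And>w. \<bar>Im w\<bar> \<le> \<bar>\<theta>\<bar> \<Longrightarrow> norm (h w * exp (s * w)) \<le> C * exp (- 1 * \<bar>Re w\<bar>)"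
    using rapid_decay_mult_exp[OF dec \<theta> norm_ge_zero[of s]] by (metis order_refl)
  show ?thesis
  proof (rule integrable_exp_decay)
    show "(\<lambda>u. h (complex_of_real u + \<i> * \<theta>) * exp (s * (complex_of_real u + \<i> * \<theta>))) \<in> borel_measurable borel"
      by (rule holomorphic_measurable_line[where f = "\<lambda>w. h w * exp (s * w)"]) (use \<theta> in \<open>auto intro!: holomorphic_intros hol\<close>)
    show "norm (h (complex_of_real u + \<i> * \<theta>) * exp (s * (complex_of_real u + \<i> * \<theta>))) \<le> C * exp (- \<bar>u\<bar>)" for u
      using C(2)[of "complex_of_real u + \<i> * \<theta>"] by simp
  qed
qed

lemma mellin_shift:
  assumes hol: "h holomorphic_on strip" and dec: "rapid_decay h" and \<theta>: "\<bar>\<theta>\<bar> < pi / 2"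
  shows "mellin h s = (LINT u|lborel. h (complex_of_real u + \<i> * \<theta>) * exp (s * (complex_of_real u + \<i> * \<theta>)))"
proof -
  obtain C where C: "C \<ge> 0" "\<And>w. \<bar>Im w\<bar> \<le> \<bar>\<theta>\<bar> \<Longrightarrow> norm (h w * exp (s * w)) \<le> C * exp (- 1 * \<bar>Re w\<bar>)"
    using rapid_decay_mult_exp[OF dec \<theta> norm_ge_zero[of s]] by (metis order_refl)
  have "(LINT u|lborel. h (complex_of_real u + \<i> * \<theta>) * exp (s * (complex_of_real u + \<i> * \<theta>))) =
    (LINT u|lborel. h (complex_of_real u) * exp (s * complex_of_real u))"
    by (rule integral_shift_strip[where \<Phi> = "\<lambda>w. h w * exp (s * w)"])
       (use C(2) \<theta> in \<open>auto intro!: holomorphic_intros hol\<close>)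
  then show ?thesis
    by (simp add: mellin_def)
qed

text \<open>Integrals over \<open>{-n..n}\<close> are entire by differentiation under the integral
  sign, and they converge locally uniformly because the tails are exponentially small in
  \<open>n\<close> on each unit disc.\<close>

lemma mellin_entire:
  assumes hol: "h holomorphic_on strip" and dec: "rapid_decay h"
  shows "mellin h holomorphic_on UNIV"
proof -
  define f where "f = (\<lambda>n s. integral (cbox (- real n) (real n)) (\<lambda>u. h (complex_of_real u) * exp (s * complex_of_real u)))"
  have hc: "continuous_on UNIV (\<lambda>u. h (complex_of_real u))"
    using holomorphic_measurable_line(2)[OF hol, of 0] by simp
  show ?thesis
  proof (rule holomorphic_uniform_sequence[of UNIV f])
    show "f n holomorphic_on UNIV" for n
      unfolding f_def
    proof (rule leibniz_rule_holomorphic)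
      show "((\<lambda>s. h (complex_of_real u) * exp (s * complex_of_real u)) has_field_derivative
          h (complex_of_real u) * (exp (s * complex_of_real u) * complex_of_real u)) (at s within UNIV)" for s u
        by (auto intro!: derivative_eq_intros)
      show "(\<lambda>u. h (complex_of_real u) * exp (s * complex_of_real u)) integrable_on cbox (- real n) (real n)" for s
        by (intro integrable_continuous continuous_intros continuous_on_subset[OF hc]) auto
      have "continuous_on (UNIV \<times> cbox (- real n) (real n)) (\<lambda>x::complex \<times> real. h (complex_of_real (snd x)))"
        by (rule continuous_on_compose2[OF hc]) (auto intro!: continuous_intros)
      then show "continuous_on (UNIV \<times> cbox (- real n) (real n))
          (\<lambda>(s, u). h (complex_of_real u) * (exp (s * complex_of_real u) * complex_of_real u))"
        by (auto simp: case_prod_unfold intro!: continuous_intros)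
    qed auto
    fix s0 :: complex
    define R where "R = norm s0 + 1"
    \<comment> \<open>Rate 2 is split in half: outside \<open>{-n..n}\<close> one factor
      \<open>exp (- \<bar>u\<bar>)\<close> is at most \<open>exp (- n)\<close>, and the other keeps
      the tail integrable.\<close>
    obtain C where C: "C \<ge> 0" "\<And>w s. \<bar>Im w\<bar> \<le> \<bar>0::real\<bar> \<Longrightarrow> norm s \<le> R \<Longrightarrow> norm (h w * exp (s * w)) \<le> C * exp (- 2 * \<bar>Re w\<bar>)"
      by (rule rapid_decay_mult_exp[OF dec, of 0 R 2]) (auto simp: R_def)
    define K where "K = (LINT u|lborel. exp (- \<bar>u::real\<bar>))"
    have est: "norm (f n s - mellin h s) \<le> C * exp (- real n) * K" if s: "s \<in> cball s0 1" for n s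
    proof -
      have sR: "norm s \<le> R"
        using s norm_triangle_ineq2[of s s0] by (simp add: R_def dist_norm norm_minus_commute)
      define \<phi> where "\<phi> = (\<lambda>u. h (complex_of_real u) * exp (s * complex_of_real u))"
      have int: "integrable lborel \<phi>"
        using mellin_integrable[OF hol dec, of 0 s] by (simp add: \<phi>_def)
      have int': "set_integrable lborel {-real n..real n} \<phi>"
        using int by (auto simp: set_integrable_def intro!: integrable_mult_indicator)
      have "f n s = (LINT u|lborel. indicator {-real n..real n} u *\<^sub>R \<phi> u)"
        using set_borel_integral_eq_integral(2)[OF int'] by (simp add: f_def \<phi>_def set_lebesgue_integral_def)
      then have "mellin h s - f n s = (LINT u|lborel. \<phi> u - indicator {-real n..real n} u *\<^sub>R \<phi> u)"
        using int int' by (simp add: mellin_def \<phi>_def set_integrable_def)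
      also have "norm \<dots> \<le> (LINT u|lborel. C * exp (- real n) * exp (- \<bar>u\<bar>))"
      proof (rule Bochner_Integration.integral_norm_bound_integral)
        show "integrable lborel (\<lambda>u. \<phi> u - indicator {-real n..real n} u *\<^sub>R \<phi> u)"
          using int int' by (simp add: set_integrable_def)
        show "integrable lborel (\<lambda>u. C * exp (- real n) * exp (- \<bar>u\<bar>))"
          using integrable_exp_minus_abs by simp
        fix u :: real
        show "norm (\<phi> u - indicator {-real n..real n} u *\<^sub>R \<phi> u) \<le> C * exp (- real n) * exp (- \<bar>u\<bar>)"
        proof (cases "u \<in> {-real n..real n}")
          case True then show ?thesis using C by simp
        next
          case False
          then have "norm (\<phi> u - indicator {-real n..real n} u *\<^sub>R \<phi> u) \<le> C * exp (- 2 * \<bar>u\<bar>)"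
            using C(2)[of "complex_of_real u" s] sR by (simp add: \<phi>_def)
          also have "\<dots> \<le> C * exp (- real n - \<bar>u\<bar>)"
            using False C by (intro mult_left_mono) auto
          finally show ?thesis by (simp add: exp_diff exp_minus field_simps)
        qed
      qed
      also have "\<dots> = C * exp (- real n) * K" by (simp add: K_def)
      finally show ?thesis by (simp add: norm_minus_commute)
    qed
    have "uniform_limit (cball s0 1) f (mellin h) sequentially"
    proof (rule uniform_limitI)
      fix e :: real assume "e > 0"
      have "(\<lambda>n. C * exp (- real n) * K) \<longlonglongrightarrow> 0" by real_asymp
      then have "eventually (\<lambda>n. C * exp (- real n) * K < e) sequentially"
        using \<open>e > 0\<close> by (rule order_tendstoD)
      then show "\<forall>\<^sub>F n in sequentially. \<forall>x\<in>cball s0 1. dist (f n x) (mellin h x) < e"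
        by eventually_elim (auto simp: dist_norm intro: order_le_less_trans[OF est] simp del: mem_cball)
    qed
    then show "\<exists>d>0. cball s0 d \<subseteq> UNIV \<and> uniform_limit (cball s0 d) f (mellin h) sequentially"
      by (intro exI[of _ 1]) auto
  qed auto
qed

section \<open>Fourier inversion with a Gaussian factor\<close>

lemma gaussian_fourier:
  assumes "\<delta> > 0"
  shows "integrable lborel (\<lambda>t. exp (\<i> * complex_of_real (t * v)) * complex_of_real (std_normal_density (\<delta> * t)))"
    and "(LINT t|lborel. exp (\<i> * complex_of_real (t * v)) * complex_of_real (std_normal_density (\<delta> * t))) =
      complex_of_real (exp (- (v / \<delta>)\<^sup>2 / 2) / \<delta>)"
proof -
  define f where "f = (\<lambda>x. exp (\<i> * complex_of_real (x * (v / \<delta>))) * complex_of_real (std_normal_density x))"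
  have f: "f (0 + \<delta> * t) = exp (\<i> * complex_of_real (t * v)) * complex_of_real (std_normal_density (\<delta> * t))" for t
    using assms by (simp add: f_def)
  have "integrable lborel f"
  proof (rule Bochner_Integration.integrable_bound)
    show "integrable lborel std_normal_density"
      by (simp add: integrable_normal_density)
    show "f \<in> borel_measurable lborel"
      unfolding f_def by measurable
    show "AE x in lborel. norm (f x) \<le> norm (std_normal_density x)"
      by (intro AE_I2) (simp add: f_def norm_mult)
  qed
  from lborel_integrable_real_affine[OF this, of \<delta> 0] assms
  show "integrable lborel (\<lambda>t. exp (\<i> * complex_of_real (t * v)) * complex_of_real (std_normal_density (\<delta> * t)))"
    unfolding f by simp
  \<comment> \<open>The Fourier transform of the Gaussian is the characteristic function of the
    standard normal distribution.\<close>
  have "(LINT x|lborel. f x) = char std_normal_distribution (v / \<delta>)"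
    unfolding char_def f_def
    by (subst integral_density) (auto simp: scaleR_conv_of_real mult_ac intro!: Bochner_Integration.integral_cong)
  also have "\<dots> = complex_of_real (exp (- (v / \<delta>)\<^sup>2 / 2))"
    by (simp add: char_std_normal_distribution)
  finally have "\<delta> *\<^sub>R (LINT t|lborel. f (0 + \<delta> * t)) = complex_of_real (exp (- (v / \<delta>)\<^sup>2 / 2))"
    using lborel_integral_real_affine[of \<delta> f 0] assms by simp
  then show "(LINT t|lborel. exp (\<i> * complex_of_real (t * v)) * complex_of_real (std_normal_density (\<delta> * t))) =
      complex_of_real (exp (- (v / \<delta>)\<^sup>2 / 2) / \<delta>)"
    unfolding f using assms by (simp add: scaleR_conv_of_real field_simps)
qed

text \<open>The Gaussian cuts off at \<open>\<bar>t\<bar>\<close> of order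
  \<open>1 / \<delta>\<close>. The density is \<open>1 / sqrt (2 * pi)\<close> at 0, so the limit
  for small \<delta> is \<open>2 * pi / sqrt (2 * pi)\<close> times \<open>h w\<close>; this is the
  factor in \<open>smoothed_inverse_tendsto\<close>.\<close>

definition smoothed_inverse :: "(complex \<Rightarrow> complex) \<Rightarrow> real \<Rightarrow> complex \<Rightarrow> complex" where
  "smoothed_inverse h \<delta> w =
     (LINT t|lborel. mellin h (\<i> * complex_of_real t) * exp (- \<i> * w * complex_of_real t) *
        complex_of_real (std_normal_density (\<delta> * t)))"

text \<open>Moving the integral to the line through \<open>w\<close> produces the factor
  \<open>exp (- t * Im w)\<close>, which cancels the modulus of \<open>exp (- \<i> * w * t)\<close>
  exactly.\<close>

lemma mellin_norm_bound:
  assumes hol: "h holomorphic_on strip" and dec: "rapid_decay h" and \<theta>: "\<bar>Im w\<bar> < pi / 2"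
  obtains B where "\<And>t::real. norm (mellin h (\<i> * complex_of_real t) * exp (- \<i> * w * complex_of_real t)) \<le> B"
proof
  fix t :: real
  have "norm (mellin h (\<i> * complex_of_real t)) \<le>
      (LINT u|lborel. norm (h (complex_of_real u + \<i> * Im w) * exp (\<i> * complex_of_real t * (complex_of_real u + \<i> * Im w))))"
    unfolding mellin_shift[OF hol dec \<theta>] by (rule integral_norm_bound)
  also have "\<dots> = (LINT u|lborel. norm (h (complex_of_real u + \<i> * Im w))) * exp (- t * Im w)"
    by (simp add: norm_mult algebra_simps flip: integral_mult_left_zero integral_mult_right_zero)
  finally have "norm (mellin h (\<i> * complex_of_real t)) * exp (t * Im w) \<le>
      (LINT u|lborel. norm (h (complex_of_real u + \<i> * Im w)))"
    by (simp add: exp_minus field_simps)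
  then show "norm (mellin h (\<i> * complex_of_real t) * exp (- \<i> * w * complex_of_real t)) \<le>
      (LINT u|lborel. norm (h (complex_of_real u + \<i> * Im w)))"
    by (simp add: norm_mult mult_ac)
qed

lemma smoothed_inverse_integrable:
  assumes hol: "h holomorphic_on strip" and dec: "rapid_decay h" and \<theta>: "\<bar>Im w\<bar> < pi / 2" and "\<delta> > 0"
  shows "integrable lborel (\<lambda>t. mellin h (\<i> * complex_of_real t) * exp (- \<i> * w * complex_of_real t) *
        complex_of_real (std_normal_density (\<delta> * t)))"
proof -
  obtain B where B: "\<And>t::real. norm (mellin h (\<i> * complex_of_real t) * exp (- \<i> * w * complex_of_real t)) \<le> B"
    using mellin_norm_bound[OF assms(1-3)] by blast
  have cont: "continuous_on UNIV (\<lambda>t. mellin h (\<i> * complex_of_real t))"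
    by (rule continuous_on_compose2[OF holomorphic_on_imp_continuous_on[OF mellin_entire[OF hol dec]]])
       (auto intro!: continuous_intros)
  have [measurable]: "(\<lambda>t. mellin h (\<i> * complex_of_real t)) \<in> borel_measurable borel"
    by (rule borel_measurable_continuous_onI[OF cont])
  show ?thesis
  proof (rule Bochner_Integration.integrable_bound)
    have "integrable lborel std_normal_density"
      by (simp add: integrable_normal_density)
    from lborel_integrable_real_affine[OF this, of \<delta> 0] \<open>\<delta> > 0\<close>
    show "integrable lborel (\<lambda>t. B * std_normal_density (\<delta> * t))" by simp
    show "(\<lambda>t. mellin h (\<i> * complex_of_real t) * exp (- \<i> * w * complex_of_real t) *
        complex_of_real (std_normal_density (\<delta> * t))) \<in> borel_measurable lborel"
      by measurable
    show "AE t in lborel. norm (mellin h (\<i> * complex_of_real t) * exp (- \<i> * w * complex_of_real t) *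
        complex_of_real (std_normal_density (\<delta> * t))) \<le> norm (B * std_normal_density (\<delta> * t))"
    proof (rule AE_I2)
      fix t :: real
      have "0 \<le> B" using B[of 0] norm_ge_zero order_trans by blast
      then show "norm (mellin h (\<i> * complex_of_real t) * exp (- \<i> * w * complex_of_real t) *
        complex_of_real (std_normal_density (\<delta> * t))) \<le> norm (B * std_normal_density (\<delta> * t))"
        using B[of t] by (subst norm_mult) (auto simp: abs_mult intro!: mult_right_mono)
    qed
  qed
qed

text \<open>On the line through \<open>w\<close> the phases combine to
  \<open>exp (\<i> * t * (u - Re w))\<close>. Fubini and the transform of the Gaussian then turn the
  cutoff in \<open>t\<close> into an average of \<open>h\<close> along that line, at distance of
  order \<delta> from \<open>w\<close>.\<close>

lemma smoothed_inverse_eq: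
  assumes hol: "h holomorphic_on strip" and dec: "rapid_decay h" and \<theta>: "\<bar>Im w\<bar> < pi / 2" and "\<delta> > 0"
  shows "smoothed_inverse h \<delta> w = (LINT v|lborel. h (w + complex_of_real (\<delta> * v)) * complex_of_real (exp (- v\<^sup>2 / 2)))"
proof -
  define \<phi> where "\<phi> = (\<lambda>u::real. h (complex_of_real u + \<i> * Im w))"
  have int: "integrable lborel \<phi>"
    using mellin_integrable[OF hol dec \<theta>, of 0] by (simp add: \<phi>_def)
  define F where "F = (\<lambda>t u. \<phi> u * (exp (\<i> * complex_of_real (t * (u - Re w))) * complex_of_real (std_normal_density (\<delta> * t))))"
  have [measurable]: "\<phi> \<in> borel_measurable borel"
    using int by (simp add: borel_measurable_integrable)
  have J: "mellin h (\<i> * complex_of_real t) * exp (- \<i> * w * complex_of_real t) *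
        complex_of_real (std_normal_density (\<delta> * t)) = (LINT u|lborel. F t u)" for t
  proof -
    have "exp (\<i> * complex_of_real t * (complex_of_real u + \<i> * Im w)) * exp (- \<i> * w * complex_of_real t) =
        exp (\<i> * complex_of_real (t * (u - Re w)))" for u
    proof -
      have "\<i> * complex_of_real t * (complex_of_real u + \<i> * Im w) + - \<i> * w * complex_of_real t =
          \<i> * complex_of_real (t * (u - Re w))"
        by (simp add: complex_eq_iff algebra_simps)
      then show ?thesis by (metis exp_add)
    qed
    then have F: "F t u = h (complex_of_real u + \<i> * Im w) * exp (\<i> * complex_of_real t * (complex_of_real u + \<i> * Im w)) *
        (exp (- \<i> * w * complex_of_real t) * complex_of_real (std_normal_density (\<delta> * t)))" for u
      by (metis (no_types, lifting) F_def \<phi>_def mult.assoc)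
    show ?thesis
      unfolding F mellin_shift[OF hol dec \<theta>] by (subst integral_mult_left_zero) (simp only: mult.assoc)
  qed
  have intF: "integrable (lborel \<Otimes>\<^sub>M lborel) (\<lambda>(u, t). F t u)"
  proof (rule lborel_pair.Fubini_integrable)
    show "(\<lambda>(u, t). F t u) \<in> borel_measurable (lborel \<Otimes>\<^sub>M lborel)"
      unfolding F_def by measurable
    have "(LINT t|lborel. norm (F t u)) = norm (\<phi> u) * (LINT t|lborel. std_normal_density (\<delta> * t))" for u
      by (simp add: F_def norm_mult)
    then show "integrable lborel (\<lambda>u. LINT t|lborel. norm (case (u, t) of (u, t) \<Rightarrow> F t u))"
      using int by simp
    show "AE u in lborel. integrable lborel (\<lambda>t. case (u, t) of (u, t) \<Rightarrow> F t u)"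
      unfolding F_def prod.case by (intro AE_I2 integrable_mult_right gaussian_fourier(1)[OF \<open>\<delta> > 0\<close>])
  qed
  have "smoothed_inverse h \<delta> w = (LINT t|lborel. LINT u|lborel. F t u)"
    unfolding smoothed_inverse_def J ..
  also have "\<dots> = (LINT u|lborel. LINT t|lborel. F t u)"
    using lborel_pair.Fubini_integral[OF intF] .
  also have "\<dots> = (LINT u|lborel. \<phi> u * complex_of_real (exp (- ((u - Re w) / \<delta>)\<^sup>2 / 2) / \<delta>))"
    unfolding F_def by (simp only: integral_mult_right_zero gaussian_fourier(2)[OF \<open>\<delta> > 0\<close>])
  also have "\<dots> = \<delta> *\<^sub>R (LINT v|lborel. \<phi> (Re w + \<delta> * v) * complex_of_real (exp (- ((Re w + \<delta> * v - Re w) / \<delta>)\<^sup>2 / 2) / \<delta>))"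
    by (subst lborel_integral_real_affine[of \<delta> _ "Re w"]) (use \<open>\<delta> > 0\<close> in auto)
  also have "\<dots> = (LINT v|lborel. \<delta> *\<^sub>R (\<phi> (Re w + \<delta> * v) * complex_of_real (exp (- ((Re w + \<delta> * v - Re w) / \<delta>)\<^sup>2 / 2) / \<delta>)))"
    by simp
  also have "\<dots> = (LINT v|lborel. h (w + complex_of_real (\<delta> * v)) * complex_of_real (exp (- v\<^sup>2 / 2)))"
  proof (rule Bochner_Integration.integral_cong[OF refl])
    fix v
    have "\<phi> (Re w + \<delta> * v) = h (w + complex_of_real (\<delta> * v))"
      unfolding \<phi>_def by (rule arg_cong[of _ _ h]) (simp add: complex_eq_iff)
    then show "\<delta> *\<^sub>R (\<phi> (Re w + \<delta> * v) * complex_of_real (exp (- ((Re w + \<delta> * v - Re w) / \<delta>)\<^sup>2 / 2) / \<delta>)) =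
      h (w + complex_of_real (\<delta> * v)) * complex_of_real (exp (- v\<^sup>2 / 2))"
      using \<open>\<delta> > 0\<close> by (simp add: scaleR_conv_of_real)
  qed
  finally show ?thesis .
qed

lemma integral_gauss:
  "integrable lborel (\<lambda>v::real. exp (- v\<^sup>2 / 2))" "(LINT v|lborel. exp (- v\<^sup>2 / 2)) = sqrt (2 * pi)"
proof -
  have e: "exp (- v\<^sup>2 / 2) = sqrt (2 * pi) * std_normal_density v" for v
    by (simp add: std_normal_density_def)
  show "integrable lborel (\<lambda>v::real. exp (- v\<^sup>2 / 2))"
    unfolding e by (simp add: integrable_normal_density)
  show "(LINT v|lborel. exp (- v\<^sup>2 / 2)) = sqrt (2 * pi)"
    unfolding e by (simp add: integral_normal_density)
qed

lemma smoothed_inverse_tendsto: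
  assumes hol: "h holomorphic_on strip" and dec: "rapid_decay h" and \<theta>: "\<bar>Im w\<bar> < pi / 2"
  shows "(\<lambda>n. smoothed_inverse h (1 / real (Suc n)) w) \<longlonglongrightarrow> h w * complex_of_real (sqrt (2 * pi))"
proof -
  define \<phi> where "\<phi> = (\<lambda>u::real. h (complex_of_real u + \<i> * Im w))"
  have hw: "h (w + complex_of_real v) = \<phi> (Re w + v)" for v
    unfolding \<phi>_def by (rule arg_cong[of _ _ h]) (simp add: complex_eq_iff)
  have cont: "continuous_on UNIV \<phi>"
    unfolding \<phi>_def using holomorphic_measurable_line(2)[OF hol \<theta>] .
  have [measurable]: "\<phi> \<in> borel_measurable borel"
    by (rule borel_measurable_continuous_onI[OF cont])
  obtain C where C: "C \<ge> 0" "\<And>w'. \<bar>Im w'\<bar> \<le> \<bar>Im w\<bar> \<Longrightarrow> norm (h w') \<le> C * exp (- 0 * \<bar>Re w'\<bar>)"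
    using rapid_decayE[OF dec \<theta>] by metis
  have bd: "norm (\<phi> u) \<le> C" for u
    using C(2)[of "complex_of_real u + \<i> * Im w"] by (simp add: \<phi>_def)
  have "(\<lambda>n. LINT v|lborel. \<phi> (Re w + 1 / real (Suc n) * v) * complex_of_real (exp (- v\<^sup>2 / 2)))
      \<longlonglongrightarrow> (LINT v|lborel. \<phi> (Re w) * complex_of_real (exp (- v\<^sup>2 / 2)))"
  proof (rule integral_dominated_convergence)
    show "integrable lborel (\<lambda>v. C * exp (- v\<^sup>2 / 2))"
      using integral_gauss(1) by simp
    show "AE v in lborel. (\<lambda>n. \<phi> (Re w + 1 / real (Suc n) * v) * complex_of_real (exp (- v\<^sup>2 / 2)))
        \<longlonglongrightarrow> \<phi> (Re w) * complex_of_real (exp (- v\<^sup>2 / 2))"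
    proof (intro AE_I2 tendsto_mult tendsto_const)
      fix v :: real
      have "(\<lambda>n. Re w + 1 / real (Suc n) * v) \<longlonglongrightarrow> Re w" by real_asymp
      then show "(\<lambda>n. \<phi> (Re w + 1 / real (Suc n) * v)) \<longlonglongrightarrow> \<phi> (Re w)"
        using cont by (intro continuous_on_tendsto_compose[OF cont]) auto
    qed
    show "AE v in lborel. norm (\<phi> (Re w + 1 / real (Suc n) * v) * complex_of_real (exp (- v\<^sup>2 / 2))) \<le> C * exp (- v\<^sup>2 / 2)" for n
      by (intro AE_I2, subst norm_mult) (auto intro!: mult_right_mono bd)
  qed measurable
  moreover have "smoothed_inverse h (1 / real (Suc n)) w =
      (LINT v|lborel. \<phi> (Re w + 1 / real (Suc n) * v) * complex_of_real (exp (- v\<^sup>2 / 2)))" for n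
    by (subst smoothed_inverse_eq[OF assms]) (simp_all only: hw, simp)
  moreover have "(LINT v|lborel. \<phi> (Re w) * complex_of_real (exp (- v\<^sup>2 / 2))) = h w * complex_of_real (sqrt (2 * pi))"
    using hw[of 0] by (simp only: integral_mult_right_zero integral_complex_of_real integral_gauss(2)) simp
  ultimately show ?thesis by simp
qed

text \<open>By Fourier inversion, \<open>h w\<close> is an integral over \<open>t\<close> whose integrand has a modulus independent of
  \<open>Re w\<close>. For \<open>t \<ge> T\<close> this modulus is the integrand at \<open>Re w = 0\<close>; the remaining half line contributes
  a bounded amount, since the weight \<open>exp (t * Im w)\<close> decays as \<open>t \<rightarrow> -\<infinity>\<close>.\<close>

lemma strip_bound_of_nonneg:
  assumes hol: "h holomorphic_on strip" and dec: "rapid_decay h"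
    and real: "\<And>t::real. mellin h (\<i> * complex_of_real t) \<in> \<real>"
    and nonneg: "\<And>t::real. t \<ge> T \<Longrightarrow> Re (mellin h (\<i> * complex_of_real t)) \<ge> 0"
  shows "\<exists>C. \<forall>w. 1 \<le> Im w \<longrightarrow> Im w < pi / 2 \<longrightarrow> norm (h w) \<le> norm (h (\<i> * Im w)) + C"
proof -
  define H where "H = (\<lambda>t. mellin h (\<i> * complex_of_real t))"
  obtain B where "\<And>t::real. norm (mellin h (\<i> * complex_of_real t) * exp (- \<i> * 0 * complex_of_real t)) \<le> B"
    using mellin_norm_bound[OF hol dec, of 0] by auto
  then have B: "norm (H t) \<le> B" for t by (simp add: H_def)
  then have B0: "B \<ge> 0" using norm_ge_zero order_trans by blast
  define K where "K = (LINT t|lborel. exp (- \<bar>t - T\<bar>))"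
  have intK: "integrable lborel (\<lambda>t::real. exp (- \<bar>t - T\<bar>))"
    using lborel_integrable_real_affine[OF integrable_exp_minus_abs, of 1 "-T"] by simp
  \<comment> \<open>Bounds the loss from \<open>t < T\<close>, where
    \<open>norm (H t) - Re (H t) \<le> 2 * B\<close>. There \<open>1 \<le> \<theta> \<le> 2\<close>:
    the upper bound controls \<open>exp (\<theta> * T)\<close>, and the lower one gives the decay
    \<open>exp (- \<bar>t - T\<bar>)\<close> independently of \<theta>.\<close>
  define C where "C = 2 * B * exp (2 * \<bar>T\<bar>) * K"
  have main: "norm (smoothed_inverse h \<delta> w) \<le> norm (smoothed_inverse h \<delta> (\<i> * Im w)) + C"
    if w: "1 \<le> Im w" "Im w < pi / 2" and \<delta>: "\<delta> > 0" for w \<delta>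
  proof -
    define \<theta> where "\<theta> = Im w"
    define \<rho> where "\<rho> = (\<lambda>t. std_normal_density (\<delta> * t))"
    have Hd: "mellin h (\<i> * complex_of_real t) = H t" and \<rho>d: "std_normal_density (\<delta> * t) = \<rho> t" for t
      by (simp_all add: H_def \<rho>_def)
    have \<theta>2: "\<theta> \<le> 2" using w pi_less_4 by (simp add: \<theta>_def)
    have \<rho>: "0 \<le> \<rho> t" "\<rho> t \<le> 1" for t
    proof -
      show "0 \<le> \<rho> t" by (simp add: \<rho>_def)
      have "1 \<le> sqrt (2 * pi)" using pi_gt3 by simp
      moreover have "exp (- (\<delta> * t)\<^sup>2 / 2) \<le> 1" by simp
      ultimately show "\<rho> t \<le> 1"
        unfolding \<rho>_def std_normal_density_def
        by (simp add: divide_le_eq del: real_sqrt_ge_1_iff exp_le_one_iff)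
    qed
    have aw: "\<bar>Im w\<bar> < pi / 2" "\<bar>Im (\<i> * complex_of_real (Im w))\<bar> < pi / 2" using w by auto
    note int = smoothed_inverse_integrable[OF hol dec _ \<delta>]
    have nrm: "norm (H t * exp (- \<i> * w * complex_of_real t) * complex_of_real (\<rho> t)) = norm (H t) * exp (\<theta> * t) * \<rho> t" for t
      using \<rho>[of t] by (simp add: norm_mult \<theta>_def)
    have pos: "H t * exp (- \<i> * (\<i> * Im w) * complex_of_real t) * complex_of_real (\<rho> t) =
        complex_of_real (Re (H t) * exp (\<theta> * t) * \<rho> t)" for t
    proof -
      have "- \<i> * (\<i> * complex_of_real (Im w)) * complex_of_real t = complex_of_real (\<theta> * t)"
        by (simp add: \<theta>_def complex_eq_iff)
      then have "exp (- \<i> * (\<i> * complex_of_real (Im w)) * complex_of_real t) = complex_of_real (exp (\<theta> * t))"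
        by (simp only: exp_of_real)
      moreover have "H t = complex_of_real (Re (H t))"
        using real[of t] by (simp add: H_def)
      ultimately show ?thesis
        by (metis of_real_mult)
    qed
    have int1: "integrable lborel (\<lambda>t. norm (H t) * exp (\<theta> * t) * \<rho> t)"
      using integrable_norm[OF int[OF aw(1)]] unfolding Hd \<rho>d nrm .
    have int2: "integrable lborel (\<lambda>t. complex_of_real (Re (H t) * exp (\<theta> * t) * \<rho> t))"
      using int[OF aw(2)] unfolding Hd \<rho>d pos .
    then have int2': "integrable lborel (\<lambda>t. Re (H t) * exp (\<theta> * t) * \<rho> t)"
      by (simp only: complex_of_real_integrable_eq)
    have "norm (smoothed_inverse h \<delta> w) \<le> (LINT t|lborel. norm (H t) * exp (\<theta> * t) * \<rho> t)"
      using integral_norm_bound[of lborel "\<lambda>t. H t * exp (- \<i> * w * complex_of_real t) * complex_of_real (\<rho> t)"]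
      unfolding smoothed_inverse_def Hd \<rho>d nrm .
    also have "\<dots> \<le> (LINT t|lborel. Re (H t) * exp (\<theta> * t) * \<rho> t + 2 * B * exp (2 * \<bar>T\<bar>) * exp (- \<bar>t - T\<bar>))"
    proof (rule integral_mono)
      fix t :: real
      show "norm (H t) * exp (\<theta> * t) * \<rho> t \<le> Re (H t) * exp (\<theta> * t) * \<rho> t + 2 * B * exp (2 * \<bar>T\<bar>) * exp (- \<bar>t - T\<bar>)"
      proof (cases "t \<ge> T")
        case True
        have "norm (H t) = \<bar>Re (H t)\<bar>"
          using real[of t] by (metis H_def in_Reals_norm of_real_Re norm_of_real)
        then have "norm (H t) = Re (H t)" using nonneg[OF True] by (simp add: H_def)
        then show ?thesis using B0 by simp
      next
        case False
        have "norm (H t) - Re (H t) \<le> 2 * B"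
          using B[of t] abs_Re_le_cmod[of "H t"] by linarith
        moreover have "exp (\<theta> * t) * \<rho> t \<le> exp (2 * \<bar>T\<bar>) * exp (- \<bar>t - T\<bar>)"
        proof -
          have "\<theta> * t = \<theta> * T - \<theta> * (T - t)" by (simp add: algebra_simps)
          also have "\<dots> \<le> 2 * \<bar>T\<bar> - 1 * (T - t)"
          proof (rule diff_mono)
            have "\<theta> * T \<le> \<theta> * \<bar>T\<bar>" using w by (simp add: \<theta>_def mult_left_mono)
            also have "\<dots> \<le> 2 * \<bar>T\<bar>" using \<theta>2 by (intro mult_right_mono) auto
            finally show "\<theta> * T \<le> 2 * \<bar>T\<bar>" .
            show "1 * (T - t) \<le> \<theta> * (T - t)" using False w by (intro mult_right_mono) (auto simp: \<theta>_def)
          qed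
          finally have "exp (\<theta> * t) \<le> exp (2 * \<bar>T\<bar>) * exp (- \<bar>t - T\<bar>)"
            using False by (simp add: exp_add[symmetric])
          moreover have "exp (\<theta> * t) * \<rho> t \<le> exp (\<theta> * t)"
            using \<rho>[of t] by (simp add: mult_left_le)
          ultimately show ?thesis by linarith
        qed
        ultimately have "(norm (H t) - Re (H t)) * (exp (\<theta> * t) * \<rho> t) \<le> 2 * B * (exp (2 * \<bar>T\<bar>) * exp (- \<bar>t - T\<bar>))"
          using B0 \<rho>[of t] by - (rule mult_mono; (assumption | simp))
        then show ?thesis by (simp add: algebra_simps)
      qed
    qed (use int1 int2' intK in auto)
    also have "\<dots> = (LINT t|lborel. Re (H t) * exp (\<theta> * t) * \<rho> t) + C"
      using int2' intK by (simp add: C_def K_def)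
    also have "(LINT t|lborel. Re (H t) * exp (\<theta> * t) * \<rho> t) = Re (smoothed_inverse h \<delta> (\<i> * Im w))"
      unfolding smoothed_inverse_def Hd \<rho>d pos
      by (simp only: integral_complex_of_real Re_complex_of_real)
    also have "\<dots> \<le> norm (smoothed_inverse h \<delta> (\<i> * Im w))" by (rule complex_Re_le_cmod)
    finally show ?thesis by simp
  qed
  show ?thesis
  proof (intro exI[of _ "C / sqrt (2 * pi)"] allI impI)
    fix w :: complex assume w: "1 \<le> Im w" "Im w < pi / 2"
    have 1: "(\<lambda>n. norm (smoothed_inverse h (1 / real (Suc n)) w)) \<longlonglongrightarrow> norm (h w * complex_of_real (sqrt (2 * pi)))"
      by (intro tendsto_norm smoothed_inverse_tendsto[OF hol dec]) (use w in auto)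
    have 2: "(\<lambda>n. norm (smoothed_inverse h (1 / real (Suc n)) (\<i> * Im w)) + C) \<longlonglongrightarrow>
        norm (h (\<i> * Im w) * complex_of_real (sqrt (2 * pi))) + C"
      by (intro tendsto_add tendsto_norm smoothed_inverse_tendsto[OF hol dec] tendsto_const) (use w in auto)
    have "norm (h w * complex_of_real (sqrt (2 * pi))) \<le> norm (h (\<i> * Im w) * complex_of_real (sqrt (2 * pi))) + C"
      by (rule LIMSEQ_le[OF 1 2]) (use main[OF w] in auto)
    then show "norm (h w) \<le> norm (h (\<i> * Im w)) + C / sqrt (2 * pi)"
      by (simp add: norm_mult field_simps)
  qed
qed

subsection \<open>The modular group\<close>

definition mat2 :: "int \<Rightarrow> int \<Rightarrow> int \<Rightarrow> int \<Rightarrow> int^2^2" where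
  "mat2 a b c d = vector [vector [a, b], vector [c, d]]"

lemma mat2_nth [simp]:
  "mat2 a b c d $ 1 $ 1 = a" "mat2 a b c d $ 1 $ 2 = b"
  "mat2 a b c d $ 2 $ 1 = c" "mat2 a b c d $ 2 $ 2 = d"
  by (simp_all add: mat2_def)

lemma SL2Z_iff: "A \<in> SL2Z \<longleftrightarrow> A $ 1 $ 1 * A $ 2 $ 2 - A $ 1 $ 2 * A $ 2 $ 1 = 1"
  by (simp add: SL2Z_def det_2)

lemma matmul_nth:
  fixes A B :: "int^2^2"
  shows "(A ** B) $ i $ j = A $ i $ 1 * B $ 1 $ j + A $ i $ 2 * B $ 2 $ j"
  by (simp add: matrix_matrix_mult_def sum_2)

definition adj2 :: "int^2^2 \<Rightarrow> int^2^2" where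
  "adj2 A = mat2 (A $ 2 $ 2) (- A $ 1 $ 2) (- A $ 2 $ 1) (A $ 1 $ 1)"

lemma SL2Z_mult: "A \<in> SL2Z \<Longrightarrow> B \<in> SL2Z \<Longrightarrow> A ** B \<in> SL2Z"
  by (simp add: SL2Z_def det_mul)

lemma SL2Z_adj2: "A \<in> SL2Z \<Longrightarrow> adj2 A \<in> SL2Z"
  by (simp add: SL2Z_iff adj2_def algebra_simps)

lemma adj2_mult: "A \<in> SL2Z \<Longrightarrow> adj2 A ** A = mat 1"
  by (auto simp: vec_eq_iff forall_2 matmul_nth adj2_def SL2Z_iff mat_def algebra_simps)

lemma mult_adj2_cancel: "B \<in> SL2Z \<Longrightarrow> (A ** adj2 B) ** B = A"
  by (simp add: matrix_mul_assoc[symmetric] adj2_mult)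

lemma auto_denom_nz:
  assumes "A \<in> SL2Z" and "Im z > 0"
  shows "auto_denom A z \<noteq> 0"
proof
  assume "auto_denom A z = 0"
  then have "Im (auto_denom A z) = 0" "Re (auto_denom A z) = 0" by simp_all
  then have "A $ 2 $ 1 = 0" "A $ 2 $ 2 = 0"
    using assms(2) by (auto simp: auto_denom_def)
  then show False using assms(1) by (simp add: SL2Z_iff)
qed

lemma Im_moebius:
  assumes "A \<in> SL2Z" and "Im z > 0"
  shows "Im (moebius A z) = Im z / (norm (auto_denom A z))\<^sup>2"
proof -
  have "real_of_int (A $ 1 $ 1 * A $ 2 $ 2 - A $ 1 $ 2 * A $ 2 $ 1) = 1"
    using assms(1) by (simp add: SL2Z_iff)
  then have "Im (of_int (A $ 1 $ 1) * z + of_int (A $ 1 $ 2)) * Re (auto_denom A z) -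
      Re (of_int (A $ 1 $ 1) * z + of_int (A $ 1 $ 2)) * Im (auto_denom A z) = Im z"
    by (simp add: auto_denom_def) (simp add: algebra_simps, algebra)
  then show ?thesis
    by (simp add: moebius_def Im_divide cmod_power2)
qed

lemma Im_moebius_pos:
  assumes "A \<in> SL2Z" and "Im z > 0"
  shows "Im (moebius A z) > 0"
  using assms auto_denom_nz[OF assms] by (simp add: Im_moebius)

lemma auto_denom_mult:
  assumes "B \<in> SL2Z" and "Im z > 0"
  shows "auto_denom (A ** B) z = auto_denom A (moebius B z) * auto_denom B z"
  using auto_denom_nz[OF assms]
  by (simp add: auto_denom_def[of A] moebius_def distrib_right) (simp add: auto_denom_def matmul_nth algebra_simps)

lemma moebius_mult:
  assumes "A \<in> SL2Z" "B \<in> SL2Z" and "Im z > 0"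
  shows "moebius (A ** B) z = moebius A (moebius B z)"
proof -
  have n: "auto_denom B z \<noteq> 0" "auto_denom A (moebius B z) \<noteq> 0"
    using assms by (simp_all add: auto_denom_nz Im_moebius_pos)
  have "(of_int (A $ 1 $ 1) * moebius B z + of_int (A $ 1 $ 2)) * auto_denom B z =
      of_int ((A ** B) $ 1 $ 1) * z + of_int ((A ** B) $ 1 $ 2)"
    using n(1) by (simp add: moebius_def distrib_right) (simp add: auto_denom_def matmul_nth algebra_simps)
  then show ?thesis
    using n unfolding moebius_def[of "A ** B"] moebius_def[of A "moebius B z"] auto_denom_mult[OF assms(2,3)]
    by (metis mult.commute nonzero_mult_divide_mult_cancel_left)
qed

lemma moebius_mat1 [simp]: "moebius (mat 1) z = z" "auto_denom (mat 1) z = 1"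
  by (simp_all add: moebius_def auto_denom_def mat_def)

lemma moebius_adj2:
  assumes "A \<in> SL2Z" and "Im z > 0"
  shows "moebius (adj2 A) (moebius A z) = z" "auto_denom (adj2 A) (moebius A z) * auto_denom A z = 1"
  using moebius_mult[OF SL2Z_adj2[OF assms(1)] assms] auto_denom_mult[OF assms, of "adj2 A"]
  by (simp_all add: adj2_mult[OF assms(1)])

definition transl :: "int \<Rightarrow> int^2^2" where
  "transl m = mat2 1 m 0 1"

lemma transl_SL2Z: "transl m \<in> SL2Z"
  by (simp add: SL2Z_iff transl_def)

lemma moebius_transl [simp]: "moebius (transl m) z = z + of_int m" "auto_denom (transl m) z = 1"
  by (simp_all add: moebius_def auto_denom_def transl_def)

section \<open>Multipliers and automorphy factors of half-integral weight\<close>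

lemma shimura_symbol_coprime:
  assumes "coprime c d" and "odd d"
  shows "shimura_symbol c d = 1 \<or> shimura_symbol c d = - 1"
proof -
  have "\<bar>\<Prod>p\<in>#M. Legendre c (int p)\<bar> = 1" if "\<And>p. p \<in># M \<Longrightarrow> \<not> int p dvd c" for M
    using that
  proof (induction M)
    case (add p M)
    have "\<bar>Legendre c (int p)\<bar> = 1"
      using add.prems[of p] by (auto simp: Legendre_def cong_0_iff)
    then show ?case using add by (simp add: abs_mult)
  qed simp
  moreover have "\<not> int p dvd c" if p: "p \<in># prime_factorization (nat \<bar>d\<bar>)" for p
  proof
    assume "int p dvd c"
    moreover have "p dvd nat \<bar>d\<bar>" using p by (rule in_prime_factors_imp_dvd)
    then have "int p dvd d" by (simp add: int_dvd_int_iff[symmetric] del: int_dvd_int_iff)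
    ultimately have "int p dvd 1" using assms(1) by (meson coprime_common_divisor)
    then show False using in_prime_factors_imp_prime[OF p] by auto
  qed
  ultimately have "\<bar>\<Prod>p\<in>#prime_factorization (nat \<bar>d\<bar>). Legendre c (int p)\<bar> = 1" by blast
  then show ?thesis unfolding shimura_symbol_def by auto
qed

lemma Gamma0_SL2Z: "A \<in> Gamma0 N \<Longrightarrow> A \<in> SL2Z"
  by (simp add: Gamma0_def)

lemma Gamma0_coprime:
  assumes "A \<in> Gamma0 N"
  shows "coprime (A $ 2 $ 1) (A $ 2 $ 2)"
proof (rule coprimeI)
  fix l assume "l dvd A $ 2 $ 1" "l dvd A $ 2 $ 2"
  then have "l dvd A $ 1 $ 1 * A $ 2 $ 2 - A $ 1 $ 2 * A $ 2 $ 1" by simp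
  then show "is_unit l" using assms by (simp add: Gamma0_def SL2Z_iff)
qed

lemma Gamma0_odd:
  assumes "A \<in> Gamma0 N" and "4 dvd N"
  shows "odd (A $ 2 $ 2)"
proof
  assume "even (A $ 2 $ 2)"
  moreover have "even (A $ 2 $ 1)"
  proof -
    have "even N" using assms(2) dvd_trans[of 2 4 N] by simp
    then have "2 dvd int N" by simp
    moreover have "int N dvd A $ 2 $ 1" using assms(1) by (simp add: Gamma0_def)
    ultimately show ?thesis by (rule dvd_trans)
  qed
  ultimately show False using Gamma0_coprime[OF assms(1)] coprime_common_divisor[of _ _ 2] by auto
qed

lemma sqrt_power_le:
  fixes x y :: real
  assumes "0 \<le> x" "x \<le> y" "1 \<le> y"
  shows "sqrt x ^ (2 * k + 1) \<le> y ^ (k + 1)"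
proof -
  have "sqrt x ^ (2 * k + 1) \<le> sqrt y ^ (2 * k + 1)"
    using assms by (intro power_mono real_sqrt_le_mono) auto
  also have "\<dots> \<le> sqrt y ^ (2 * (k + 1))"
    using assms by (intro power_increasing) auto
  also have "\<dots> = y ^ (k + 1)"
    using assms unfolding power_mult by simp
  finally show ?thesis .
qed

text \<open>The power \<open>z\<close> to the \<open>k + 1/2\<close>. It is multiplicative only up
  to sign, so all later use goes through its modulus, its even powers, or an explicit root.\<close>

definition wt :: "nat \<Rightarrow> complex \<Rightarrow> complex" where
  "wt k z = csqrt z ^ (2 * k + 1)"

lemma norm_wt: "norm (wt k z) = sqrt (norm z) ^ (2 * k + 1)"
  by (simp only: wt_def norm_power norm_csqrt)

lemma wt_square: "wt k z ^ 2 = z ^ (2 * k + 1)"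
  unfolding wt_def by (metis mult.commute power2_csqrt power_mult)

lemma norm_wt_mult: "norm (wt k (x * y)) = norm (wt k x) * norm (wt k y)"
  unfolding norm_wt norm_mult real_sqrt_mult power_mult_distrib ..

lemma wt_eq_0_iff [simp]: "wt k z = 0 \<longleftrightarrow> z = 0"
  by (simp add: wt_def power_eq_0_iff del: power_Suc)

lemma wt_1 [simp]: "wt k 1 = 1" by (simp add: wt_def)

text \<open>Dirichlet's approximation theorem with denominators up to \<open>(Im z)\<^sup>-\<^sup>1\<^sup>/\<^sup>2\<close> provides the bottom row.\<close>

lemma SL2Z_reduction:
  assumes z: "Im z > 0"
  obtains A where "A \<in> SL2Z" and "Im (moebius A z) \<ge> 1 / 4"
proof (cases "Im z \<ge> 1 / 4")
  case True
  then show thesis using that[of "transl 0"] by (simp add: transl_SL2Z)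
next
  case False
  define s where "s = sqrt (Im z)"
  have s: "0 < s" "s < 1 / 2" "Im z = s\<^sup>2"
    using z False real_sqrt_less_mono[of "Im z" "1 / 4"] by (simp_all add: s_def real_sqrt_divide)
  define Q where "Q = nat \<lceil>1 / s\<rceil>"
  have Q: "1 / s \<le> real Q" "real Q \<le> 1 / s + 1"
    using s of_int_ceiling_le_add_one[of "1 / s"] of_nat_nat[of "\<lceil>1 / s\<rceil>"] le_of_int_ceiling[of "1 / s"]
    by (simp_all add: Q_def)
  have "Q > 0" using Q(1) s by (metis divide_pos_pos less_le_trans of_nat_0_less_iff zero_less_one)
  then obtain h l where hl: "coprime h l" "0 < l" "l \<le> int Q" "\<bar>of_int l * Re z - of_int h\<bar> < 1 / real Q"
    using Dirichlet_approx_coprime by blast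
  obtain u v where uv: "u * h + v * l = 1"
    using bezout_int[of h l] hl(1) by auto
  \<comment> \<open>So \<open>auto_denom A z\<close> is \<open>l * z - h\<close>. Its real part is
    at most \<open>s\<close> by the approximation, its imaginary part \<open>l * s^2\<close> at most
    \<open>3/2 * s\<close> because \<open>s < 1/2\<close>. Since \<open>1 + 9/4 \<le> 4\<close>, the
    image has height at least \<open>1/4\<close>.\<close>
  define A where "A = mat2 (- u) (- v) l (- h)"
  have A: "A \<in> SL2Z" using uv by (simp add: A_def SL2Z_iff algebra_simps)
  have "1 / real Q \<le> s" using Q(1) s \<open>Q > 0\<close> by (simp add: field_simps)
  then have "\<bar>Re (auto_denom A z)\<bar> \<le> s"
    using hl(4) by (simp add: auto_denom_def A_def)
  then have "(Re (auto_denom A z))\<^sup>2 \<le> s\<^sup>2"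
    using s by (metis power2_abs power_mono abs_ge_zero)
  moreover have "\<bar>Im (auto_denom A z)\<bar> \<le> 3 / 2 * s"
  proof -
    have "\<bar>Im (auto_denom A z)\<bar> = of_int l * s\<^sup>2"
      using hl(2) s by (simp add: auto_denom_def A_def abs_mult)
    also have "\<dots> \<le> (1 / s + 1) * s\<^sup>2"
      using hl(3) Q(2) by (intro mult_right_mono) (linarith, simp)
    also have "\<dots> = s * (1 + s)" using s by (simp add: field_simps power2_eq_square)
    also have "\<dots> \<le> s * (3 / 2)" using s by (intro mult_left_mono) auto
    finally show ?thesis by simp
  qed
  then have "(Im (auto_denom A z))\<^sup>2 \<le> (3 / 2 * s)\<^sup>2"
    by (metis power2_abs power_mono abs_ge_zero)
  ultimately have "(norm (auto_denom A z))\<^sup>2 \<le> 4 * s\<^sup>2"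
    by (simp add: cmod_power2 power_mult_distrib power_divide) (use zero_le_power2[of s] in linarith)
  moreover have "(norm (auto_denom A z))\<^sup>2 > 0"
    using auto_denom_nz[OF A z] by simp
  ultimately have "Im (moebius A z) \<ge> 1 / 4"
    using s by (simp add: Im_moebius[OF A z] field_simps)
  with A that show thesis by blast
qed

text \<open>\<open>F\<close> descends to a function \<open>P\<close> on the punctured disc, whose singularity at 0 is removable.\<close>

lemma periodic_exp_decay:
  fixes F :: "complex \<Rightarrow> complex" and N :: real
  assumes hol: "F holomorphic_on {z. Im z > 0}" and N: "N > 0"
    and per: "\<And>z m. Im z > 0 \<Longrightarrow> F (z + N * of_int m) = F z"
    and lim: "(F \<longlongrightarrow> 0) (filtercomap Im at_top)"
  obtains C Y where "C \<ge> 0" and "\<And>z. Im z \<ge> Y \<Longrightarrow> norm (F z) \<le> C * exp (- 2 * pi / N * Im z)"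
proof -
  \<comment> \<open>With this scale \<open>exp (z / c)\<close> is the disc coordinate
    \<open>e(z / N)\<close>, and the ambiguity of the logarithm becomes a translation by a multiple
    of \<open>N\<close>.\<close>
  define c where "c = complex_of_real N / (2 * of_real pi * \<i>)"
  have c0: "c \<noteq> 0" using N by (simp add: c_def)
  have Imc: "Im (c * w) = - N / (2 * pi) * Re w" for w
    by (simp add: c_def Im_divide power2_eq_square field_simps)
  define P where "P = (\<lambda>\<zeta>. if \<zeta> = 0 then 0 else F (c * Ln \<zeta>))"
  have P0: "P 0 = 0" by (simp add: P_def)
  have key: "P (exp w) = F (c * w)" if w: "Re w < 0" for w
  proof -
    obtain n :: int where n: "Ln (exp w) = w + (of_int (2 * n) * pi) * \<i>"
      using exp_eq[of "Ln (exp w)" w] by auto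
    have "c * Ln (exp w) = c * w + N * of_int n"
      unfolding n by (simp add: c_def field_simps)
    moreover have "Im (c * w) > 0" unfolding Imc using w N by (simp add: mult_pos_neg divide_neg_pos)
    ultimately show ?thesis using per[of "c * w" n] by (simp only: P_def exp_not_eq_zero if_False)
  qed
  have P_diff: "P field_differentiable at \<zeta>0" if \<zeta>0: "\<zeta>0 \<in> ball 0 1 - {0}" for \<zeta>0
  proof -
    \<comment> \<open>Rotation by \<open>cnj \<zeta>0\<close> makes \<open>d * \<zeta>0\<close>
      positive and so moves the branch cut away from \<open>\<zeta>0\<close>. By \<open>key\<close>,
      \<open>P\<close> may be computed with the rotated branch as well.\<close>
    define d where "d = cnj \<zeta>0"
    define S where "S = (ball 0 1 - {0}) \<inter> (\<lambda>\<zeta>. d * \<zeta>) -` (- \<real>\<^sub>\<le>\<^sub>0)"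
    have "open S" unfolding S_def
      by (intro open_Int open_vimage open_Compl closed_nonpos_Reals_complex open_Diff) (auto intro!: continuous_intros)
    have "d * \<zeta>0 = of_real ((norm \<zeta>0)\<^sup>2)"
      unfolding d_def complex_norm_square by (rule mult.commute)
    then have "\<zeta>0 \<in> S" using \<zeta>0 by (simp add: S_def complex_nonpos_Reals_iff)
    have d0: "d \<noteq> 0" using \<zeta>0 by (simp add: d_def)
    have e: "exp (Ln (d * \<zeta>) - Ln d) = \<zeta>" if "\<zeta> \<noteq> 0" for \<zeta>
      using that d0 by (simp add: exp_diff)
    have re: "Re (Ln (d * \<zeta>) - Ln d) < 0" if "\<zeta> \<in> S" for \<zeta>
    proof -
      have "norm \<zeta> = exp (Re (Ln (d * \<zeta>) - Ln d))"
        using e[of \<zeta>] that by (metis DiffE IntE S_def insertI1 norm_exp_eq_Re)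
      then have "exp (Re (Ln (d * \<zeta>) - Ln d)) < 1" using that by (simp add: S_def)
      then show ?thesis by simp
    qed
    have pos: "Im (c * w) > 0" if "Re w < 0" for w
      unfolding Imc using that N by (simp add: mult_pos_neg divide_neg_pos)
    have "(\<lambda>\<zeta>. c * (Ln (d * \<zeta>) - Ln d)) holomorphic_on S"
      by (intro holomorphic_intros) (auto simp: S_def)
    then have "(F \<circ> (\<lambda>\<zeta>. c * (Ln (d * \<zeta>) - Ln d))) holomorphic_on S"
      by (rule holomorphic_on_compose_gen[OF _ hol])
         (use pos[OF re] in blast)
    then have "P holomorphic_on S"
    proof (rule holomorphic_transform)
      fix \<zeta> assume "\<zeta> \<in> S"
      then show "(F \<circ> (\<lambda>\<zeta>. c * (Ln (d * \<zeta>) - Ln d))) \<zeta> = P \<zeta>"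
        using key[OF re, of \<zeta>] e[of \<zeta>] by (simp add: S_def)
    qed
    then show ?thesis
      using \<open>open S\<close> \<open>\<zeta>0 \<in> S\<close> by (rule holomorphic_on_imp_differentiable_at)
  qed
  have Im_big: "Im (c * Ln \<zeta>) \<ge> Y" if "\<zeta> \<noteq> 0" "norm \<zeta> < exp (- 2 * pi * Y / N)" for \<zeta> Y
  proof -
    have "ln (norm \<zeta>) < - 2 * pi * Y / N"
      using that by (metis exp_less_cancel_iff exp_ln zero_less_norm_iff)
    then show ?thesis unfolding Imc using that N by (simp add: field_simps)
  qed
  have "(P \<longlongrightarrow> P 0) (at 0)"
  proof (rule tendstoI)
    fix e :: real assume "e > 0"
    with lim have "eventually (\<lambda>z. dist (F z) 0 < e) (filtercomap Im at_top)" by (rule tendstoD)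
    then obtain Y where Y: "\<And>z. Im z \<ge> Y \<Longrightarrow> dist (F z) 0 < e"
      unfolding eventually_filtercomap eventually_at_top_linorder by auto
    have "dist (P \<zeta>) (P 0) < e" if "\<zeta> \<noteq> 0" "dist \<zeta> 0 < exp (- 2 * pi * Y / N)" for \<zeta>
      using Y[OF Im_big[of \<zeta> Y]] that by (simp add: P_def)
    then show "eventually (\<lambda>\<zeta>. dist (P \<zeta>) (P 0) < e) (at 0)"
      unfolding eventually_at by (intro exI[of _ "exp (- 2 * pi * Y / N)"]) auto
  qed
  then have P_lim: "(P \<longlongrightarrow> P 0) (at 0 within ball 0 1)"
    by (rule tendsto_within_subset) simp
  have "P holomorphic_on ball 0 1"
  proof (rule no_isolated_singularity'[of "{0}"])
    show "P holomorphic_on ball 0 1 - {0}"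
      unfolding holomorphic_on_def using P_diff field_differentiable_at_within by blast
  qed (use P_lim in simp_all)
  then obtain D where "(P has_field_derivative D) (at 0)"
    using holomorphic_on_imp_differentiable_at[of P "ball 0 1" 0] by (auto simp: field_differentiable_def)
  then have "((\<lambda>\<zeta>. P \<zeta> / \<zeta>) \<longlongrightarrow> D) (at 0)"
    by (simp add: DERIV_def P0)
  then have "((\<lambda>\<zeta>. norm (P \<zeta> / \<zeta>)) \<longlongrightarrow> norm D) (at 0)" by (rule tendsto_norm)
  then have "eventually (\<lambda>\<zeta>. norm (P \<zeta> / \<zeta>) < norm D + 1) (at 0)"
    by (rule order_tendstoD) simp
  then obtain r where r: "r > 0" "\<And>\<zeta>. \<zeta> \<noteq> 0 \<Longrightarrow> norm \<zeta> < r \<Longrightarrow> norm (P \<zeta> / \<zeta>) < norm D + 1"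
    unfolding eventually_at by auto
  define Y where "Y = max 1 (1 - N / (2 * pi) * ln r)"
  show thesis
  proof (rule that[of "norm D + 1" Y])
    fix z assume z: "Im z \<ge> Y"
    define \<zeta> where "\<zeta> = exp (z / c)"
    have Re: "Re (z / c) = - 2 * pi / N * Im z"
      using N by (simp add: c_def Re_divide power2_eq_square field_simps)
    have n\<zeta>: "norm \<zeta> = exp (- 2 * pi / N * Im z)" by (simp only: \<zeta>_def norm_exp_eq_Re Re)
    have "Im z > - N / (2 * pi) * ln r" using z by (simp add: Y_def)
    then have "- 2 * pi / N * Im z < ln r" using N by (simp add: field_simps)
    then have "norm \<zeta> < r" unfolding n\<zeta> using r(1) by (metis exp_less_cancel_iff exp_ln)
    have "Im z > 0" using z by (simp add: Y_def)
    then have "Re (z / c) < 0" unfolding Re using N by (simp add: divide_pos_pos)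
    then have "F z = P \<zeta>" using key[of "z / c"] c0 by (simp add: \<zeta>_def)
    moreover have "norm (P \<zeta> / \<zeta>) < norm D + 1" using r(2) \<open>norm \<zeta> < r\<close> by (simp add: \<zeta>_def)
    ultimately have "norm (F z) \<le> (norm D + 1) * norm \<zeta>"
      by (simp add: norm_divide \<zeta>_def divide_less_eq)
    then show "norm (F z) \<le> (norm D + 1) * exp (- 2 * pi / N * Im z)" unfolding n\<zeta> .
  qed simp
qed

subsection \<open>Growth and Fourier coefficients\<close>

locale half_integral_form =
  fixes k N :: nat and g :: "complex \<Rightarrow> complex" and b :: "nat \<Rightarrow> complex"
  assumes N_pos: "N > 0" and N4: "4 dvd N"
    and form: "g \<in> half_integral_cusp_forms k N"
    and series: "\<And>z. Im z > 0 \<Longrightarrow>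
           ((\<lambda>n. b n * of_real (real n powr (real k / 2 - 1 / 4)) * e_fun (of_nat n * z))
              has_sum g z) {1..}"
begin

lemma hol: "g holomorphic_on {z. Im z > 0}"
  using form by (simp add: half_integral_cusp_forms_def upper_half_plane_def)

definition mult_fac :: "int^2^2 \<Rightarrow> complex" where
  "mult_fac A = of_int (shimura_symbol (A $ 2 $ 1) (A $ 2 $ 2)) ^ (2 * k + 1) *
          eps (A $ 2 $ 2) powi (- 1 - 2 * int k)"

lemma transform:
  assumes "A \<in> Gamma0 N" and "Im z > 0"
  shows "g (moebius A z) = mult_fac A * wt k (auto_denom A z) * g z"
  using form assms unfolding half_integral_cusp_forms_def upper_half_plane_def mult_fac_def wt_def by blast

lemma mult_fac_4:
  assumes "A \<in> Gamma0 N"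
  shows "mult_fac A ^ 4 = 1"
proof -
  have "complex_of_int (shimura_symbol (A $ 2 $ 1) (A $ 2 $ 2)) ^ 4 = 1"
    using shimura_symbol_coprime[OF Gamma0_coprime Gamma0_odd, OF assms assms N4] by auto
  moreover have "eps (A $ 2 $ 2) ^ 4 = 1" by (simp add: eps_def)
  moreover have "(x powi m) ^ 4 = (x ^ 4) powi m" for x :: complex and m
    by (cases "m \<ge> 0") (auto simp: power_int_def power_mult[symmetric] mult.commute power_inverse)
  ultimately show ?thesis
    unfolding mult_fac_def power_mult_distrib power_mult[symmetric]
    by (simp only: mult.commute[of _ 4] power_mult) simp
qed

lemma norm_mult_fac:
  assumes "A \<in> Gamma0 N"
  shows "norm (mult_fac A) = 1"
proof -
  have "norm (mult_fac A) ^ 4 = 1"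
    using arg_cong[OF mult_fac_4[OF assms], of norm] by (simp add: norm_power)
  then have "norm (mult_fac A) ^ 4 = 1 ^ 4" by simp
  then show ?thesis
    using power_eq_imp_eq_base[of "norm (mult_fac A)" 4 1] by simp
qed

lemma norm_transform:
  assumes "A \<in> Gamma0 N" and "Im z > 0"
  shows "norm (g (moebius A z)) = norm (wt k (auto_denom A z)) * norm (g z)"
  by (simp add: transform[OF assms] norm_mult norm_mult_fac[OF assms(1)])

section \<open>Slashes by the full modular group\<close>

definition slash :: "int^2^2 \<Rightarrow> complex \<Rightarrow> complex" where
  "slash A z = g (moebius A z) / wt k (auto_denom A z)"

lemma slash_tendsto:
  assumes "A \<in> SL2Z"
  shows "(slash A \<longlongrightarrow> 0) (filtercomap Im at_top)"
  using form assms unfolding half_integral_cusp_forms_def slash_def[abs_def] wt_def by blast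

text \<open>The multiplier consists of fourth roots of unity and the branch of the root only matters up to
  sign, so both disappear in the fourth power.\<close>

lemma slash_pow4_left:
  assumes "A \<in> Gamma0 N" and "B \<in> SL2Z" and "Im z > 0"
  shows "slash (A ** B) z ^ 4 = slash B z ^ 4"
proof -
  have "auto_denom A (moebius B z) \<noteq> 0"
    using assms by (intro auto_denom_nz Im_moebius_pos Gamma0_SL2Z[OF assms(1)])
  moreover have "wt k x ^ 4 = x ^ (2 * (2 * k + 1))" for x
    using arg_cong[OF wt_square, of "\<lambda>y. y ^ 2" k x]
    by (simp only: power_mult[symmetric]) (simp add: mult.commute)
  ultimately show ?thesis
    using assms(2,3)
    by (simp add: slash_def power_divide power_mult_distrib auto_denom_mult moebius_mult Gamma0_SL2Z[OF assms(1)]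
        transform[OF assms(1)] mult_fac_4[OF assms(1)] Im_moebius_pos del: power_Suc)
qed

text \<open>The lower left entry of \<open>A ** adj2 B\<close> is the determinant of the two bottom
  rows, which vanishes mod \<open>N\<close> when the rows agree mod \<open>N\<close>. Hence
  \<open>A\<close> and \<open>B\<close> differ by a left factor in \<open>Gamma0 N\<close>.\<close>

lemma slash_pow4_cong:
  assumes "A \<in> SL2Z" and "B \<in> SL2Z" and "Im z > 0"
    and "[A $ 2 $ 1 = B $ 2 $ 1] (mod int N)" "[A $ 2 $ 2 = B $ 2 $ 2] (mod int N)"
  shows "slash A z ^ 4 = slash B z ^ 4"
proof -
  have "[A $ 2 $ 1 * B $ 2 $ 2 - A $ 2 $ 2 * B $ 2 $ 1 = B $ 2 $ 1 * B $ 2 $ 2 - B $ 2 $ 2 * B $ 2 $ 1] (mod int N)"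
    by (intro cong_diff cong_mult assms(4,5) cong_refl)
  then have "int N dvd A $ 2 $ 1 * B $ 2 $ 2 - A $ 2 $ 2 * B $ 2 $ 1"
    by (simp add: mult.commute cong_0_iff)
  then have "A ** adj2 B \<in> Gamma0 N"
    using SL2Z_mult[OF assms(1) SL2Z_adj2[OF assms(2)]] by (simp add: Gamma0_def matmul_nth adj2_def)
  from slash_pow4_left[OF this assms(2,3)] show ?thesis
    by (simp add: mult_adj2_cancel[OF assms(2)])
qed

lemma norm_slash_cong:
  assumes "A \<in> SL2Z" and "B \<in> SL2Z" and "Im z > 0"
    and "[A $ 2 $ 1 = B $ 2 $ 1] (mod int N)" "[A $ 2 $ 2 = B $ 2 $ 2] (mod int N)"
  shows "norm (slash A z) = norm (slash B z)"
proof (rule power_eq_imp_eq_base)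
  show "norm (slash A z) ^ 4 = norm (slash B z) ^ 4"
    using slash_pow4_cong[OF assms] by (metis norm_power)
qed auto

lemma slash_transl: "A \<in> SL2Z \<Longrightarrow> Im z > 0 \<Longrightarrow> slash (A ** transl m) z = slash A (z + of_int m)"
  by (simp add: slash_def auto_denom_mult moebius_mult transl_SL2Z)

text \<open>Right multiplication by \<open>transl (N * m)\<close> turns the bottom row
  \<open>(c, d)\<close> into \<open>(c, d + c * N * m)\<close>, the same row mod
  \<open>N\<close>.\<close>

lemma slash_pow4_periodic:
  assumes "A \<in> SL2Z" and "Im z > 0"
  shows "slash A (z + of_int (int N * m)) ^ 4 = slash A z ^ 4"
  unfolding slash_transl[OF assms, symmetric]
  by (rule slash_pow4_cong)
     (use assms in \<open>simp_all add: SL2Z_mult transl_SL2Z, simp_all add: matmul_nth transl_def cong_iff_dvd_diff\<close>)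

lemma norm_slash_periodic:
  assumes "A \<in> SL2Z" and "Im z > 0"
  shows "norm (slash A (z + of_int (int N * m))) = norm (slash A z)"
  using arg_cong[OF slash_pow4_periodic[OF assms, of m], of norm]
  by (auto simp: norm_power intro: power_eq_imp_eq_base)

text \<open>Squaring replaces the root by the polynomial
  \<open>auto_denom A z ^ (2 * k + 1)\<close>, so that no branch has to be discussed.\<close>

lemma slash_hol:
  assumes "A \<in> SL2Z"
  shows "(\<lambda>z. slash A z ^ 2) holomorphic_on {z. Im z > 0}"
    and "continuous_on {z. Im z > 0} (\<lambda>z. norm (slash A z))"
proof -
  have nz: "auto_denom A z \<noteq> 0" if "Im z > 0" for z using auto_denom_nz[OF assms that] .
  have h1: "auto_denom A holomorphic_on {z. Im z > 0}"
    unfolding auto_denom_def by (intro holomorphic_intros)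
  have h2: "(\<lambda>z. moebius A z) holomorphic_on {z. Im z > 0}"
    unfolding moebius_def using h1 nz by (intro holomorphic_intros) auto
  have h3: "(\<lambda>z. g (moebius A z)) holomorphic_on {z. Im z > 0}"
    using holomorphic_on_compose_gen[OF h2 hol] Im_moebius_pos[OF assms] by (auto simp: o_def)
  have "slash A z ^ 2 = g (moebius A z) ^ 2 / auto_denom A z ^ (2 * k + 1)" for z
    by (simp only: slash_def power_divide wt_square)
  then show "(\<lambda>z. slash A z ^ 2) holomorphic_on {z. Im z > 0}"
    using h1 h3 nz by (auto intro!: holomorphic_intros)
  have "norm (slash A z) = norm (g (moebius A z)) / sqrt (norm (auto_denom A z)) ^ (2 * k + 1)" for z
    by (simp add: slash_def norm_divide norm_wt)
  then show "continuous_on {z. Im z > 0} (\<lambda>z. norm (slash A z))"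
    using holomorphic_on_imp_continuous_on[OF h3] holomorphic_on_imp_continuous_on[OF h1] nz
    by (auto intro!: continuous_intros)
qed

text \<open>High up, vanishing at the cusp gives the bound. Below that, periodicity of the modulus
  brings the point into a compact rectangle of width \<open>N\<close>.\<close>

lemma slash_bounded:
  assumes A: "A \<in> SL2Z"
  shows "\<exists>M. \<forall>z. Im z \<ge> 1 / 4 \<longrightarrow> norm (slash A z) \<le> M"
proof -
  have "eventually (\<lambda>z. dist (slash A z) 0 < 1) (filtercomap Im at_top)"
    using slash_tendsto[OF A] by (rule tendstoD) simp
  then obtain Y where Y: "\<And>z. Im z \<ge> Y \<Longrightarrow> norm (slash A z) < 1"
    unfolding eventually_filtercomap eventually_at_top_linorder by auto
  define R where "R = cbox (Complex 0 (1 / 4)) (Complex (real N) Y)"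
  have "compact ((\<lambda>z. norm (slash A z)) ` R)"
    unfolding R_def
    by (intro compact_continuous_image continuous_on_subset[OF slash_hol(2)[OF A]] compact_cbox)
       (auto simp: in_cbox_complex_iff)
  then obtain M where M: "\<And>z. z \<in> R \<Longrightarrow> norm (slash A z) \<le> M"
    by (auto dest!: compact_imp_bounded simp: bounded_iff) (use that in blast)
  have "norm (slash A z) \<le> max 1 M" if z: "Im z \<ge> 1 / 4" for z
  proof (cases "Im z \<ge> Y")
    case True then show ?thesis using Y[of z] by simp
  next
    case False
    define m where "m = \<lfloor>Re z / real N\<rfloor>"
    define z' where "z' = z + of_int (int N * (- m))"
    have "real_of_int m \<le> Re z / real N" "Re z / real N < real_of_int m + 1"
      unfolding m_def by linarith+
    then have "0 \<le> Re z'" "Re z' \<le> real N"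
      using N_pos by (simp_all add: z'_def field_simps)
    moreover have "Im z' = Im z" by (simp add: z'_def)
    ultimately have "z' \<in> R" using False z by (simp add: R_def in_cbox_complex_iff)
    moreover have "norm (slash A z') = norm (slash A z)"
      unfolding z'_def by (rule norm_slash_periodic[OF A]) (use z in simp)
    ultimately show ?thesis using M[of z'] by simp
  qed
  then show ?thesis by blast
qed

text \<open>The modulus of \<open>slash A\<close> depends only on the bottom row of \<open>A\<close>
  mod \<open>N\<close>, so there are only finitely many functions to bound.\<close>

lemma slash_bounded_uniform:
  obtains M where "\<And>A z. A \<in> SL2Z \<Longrightarrow> Im z \<ge> 1 / 4 \<Longrightarrow> norm (slash A z) \<le> M"
proof -
  obtain F where F: "\<And>A z. A \<in> SL2Z \<Longrightarrow> Im z \<ge> 1 / 4 \<Longrightarrow> norm (slash A z) \<le> F A"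
    using slash_bounded by metis
  define row where "row = (\<lambda>A::int^2^2. (A $ 2 $ 1 mod int N, A $ 2 $ 2 mod int N))"
  define rep where "rep = (\<lambda>r. SOME A. A \<in> SL2Z \<and> row A = r)"
  have rep: "rep (row A) \<in> SL2Z \<and> row (rep (row A)) = row A" if "A \<in> SL2Z" for A
    unfolding rep_def by (rule someI[of _ A]) (use that in auto)
  have fin: "finite (row ` SL2Z)"
  proof (rule finite_subset)
    show "row ` SL2Z \<subseteq> {0..<int N} \<times> {0..<int N}"
      using N_pos by (auto simp: row_def)
  qed simp
  show thesis
  proof (rule that)
    fix A z assume A: "A \<in> SL2Z" and z: "Im z \<ge> 1 / 4"
    have "norm (slash A z) = norm (slash (rep (row A)) z)"
      by (rule norm_slash_cong) (use A z rep[OF A] in \<open>auto simp: row_def cong_def\<close>)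
    also have "\<dots> \<le> F (rep (row A))" using rep[OF A] z by (intro F) auto
    also have "\<dots> \<le> Max ((\<lambda>r. F (rep r)) ` row ` SL2Z)"
      using fin A by (intro Max_ge) auto
    finally show "norm (slash A z) \<le> Max ((\<lambda>r. F (rep r)) ` row ` SL2Z)" .
  qed
qed

text \<open>Transfers estimates from high in the half plane to low points: \<open>A\<close> is
  chosen so that \<open>moebius A z\<close> lies high, where slashes are under control.\<close>

lemma g_eq_slash:
  assumes "A \<in> SL2Z" and "Im z > 0"
  shows "norm (g z) = norm (slash (adj2 A) (moebius A z)) / norm (wt k (auto_denom A z))"
proof -
  have "norm (wt k (auto_denom (adj2 A) (moebius A z))) * norm (wt k (auto_denom A z)) = 1"
    using moebius_adj2(2)[OF assms] by (simp flip: norm_wt_mult)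
  moreover have "norm (wt k (auto_denom A z)) \<noteq> 0"
    using auto_denom_nz[OF assms] by simp
  ultimately show ?thesis
    using moebius_adj2(1)[OF assms]
    by (simp add: slash_def norm_divide field_simps del: norm_eq_zero)
qed

text \<open>After reduction to height \<open>1/4\<close> only the factor
  \<open>\<bar>c z + d\<bar>\<close> to the power \<open>- (k + 1/2)\<close> remains. This modulus
  is at least \<open>Im z\<close> if \<open>c\<close> is nonzero, and it is 1 otherwise.\<close>

lemma moderate_growth:
  obtains M where "M \<ge> 0" and "\<And>z. Im z > 0 \<Longrightarrow> norm (g z) \<le> M * (1 + 1 / Im z) ^ (k + 1)"
proof -
  obtain M where M: "\<And>A z. A \<in> SL2Z \<Longrightarrow> Im z \<ge> 1 / 4 \<Longrightarrow> norm (slash A z) \<le> M"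
    using slash_bounded_uniform by blast
  have "0 \<le> M"
    using order_trans[OF norm_ge_zero M[OF transl_SL2Z[of 0], of \<i>]] by simp
  show thesis
  proof (rule that[OF \<open>0 \<le> M\<close>])
    fix z assume z: "Im z > 0"
    obtain A where A: "A \<in> SL2Z" "Im (moebius A z) \<ge> 1 / 4"
      using SL2Z_reduction[OF z] by blast
    define j where "j = norm (auto_denom A z)"
    have j0: "j > 0" using auto_denom_nz[OF A(1) z] by (simp add: j_def)
    have "1 / j \<le> 1 + 1 / Im z"
    proof (cases "A $ 2 $ 1 = 0")
      case True
      then have "A $ 1 $ 1 * A $ 2 $ 2 = 1" using A(1) by (simp add: SL2Z_iff)
      then have "A $ 2 $ 2 = 1 \<or> A $ 2 $ 2 = - 1" by (auto simp: zmult_eq_1_iff)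
      then have "j = 1" using True by (auto simp: j_def auto_denom_def)
      then show ?thesis using z by simp
    next
      case False
      then have "1 \<le> \<bar>real_of_int (A $ 2 $ 1)\<bar>" by linarith
      then have "Im z \<le> \<bar>real_of_int (A $ 2 $ 1)\<bar> * Im z" using z by simp
      also have "\<dots> = \<bar>Im (auto_denom A z)\<bar>" using z by (simp add: auto_denom_def abs_mult)
      also have "\<dots> \<le> j" unfolding j_def by (rule abs_Im_le_cmod)
      finally have "1 / j \<le> 1 / Im z" using z by (simp add: frac_le)
      then show ?thesis by simp
    qed
    then have "sqrt (1 / j) ^ (2 * k + 1) \<le> (1 + 1 / Im z) ^ (k + 1)"
      using j0 z by (intro sqrt_power_le) auto
    then have "1 / sqrt j ^ (2 * k + 1) \<le> (1 + 1 / Im z) ^ (k + 1)"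
      by (simp add: real_sqrt_divide power_one_over power_divide)
    then have "norm (slash (adj2 A) (moebius A z)) * (1 / sqrt j ^ (2 * k + 1)) \<le> M * (1 + 1 / Im z) ^ (k + 1)"
      using M[OF SL2Z_adj2[OF A(1)] A(2)] \<open>0 \<le> M\<close> j0 by (intro mult_mono) auto
    then show "norm (g z) \<le> M * (1 + 1 / Im z) ^ (k + 1)"
      unfolding g_eq_slash[OF A(1) z] by (simp add: norm_wt j_def)
  qed
qed

text \<open>The fourth power has period \<open>N\<close> and therefore decays at rate
  \<open>2 * pi / N\<close>; the fourth root divides the rate by 4.\<close>

lemma slash_exp_decay:
  assumes A: "A \<in> SL2Z"
  obtains C Y where "C \<ge> 0" and "\<And>z. Im z \<ge> Y \<Longrightarrow> norm (slash A z) \<le> C * exp (- pi / (2 * real N) * Im z)"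
proof -
  have "(\<lambda>z. (slash A z ^ 2) ^ 2) holomorphic_on {z. Im z > 0}"
    by (rule holomorphic_on_power[OF slash_hol(1)[OF A]])
  then have hol4: "(\<lambda>z. slash A z ^ 4) holomorphic_on {z. Im z > 0}"
    by (simp only: power_mult[symmetric]) simp
  have "((\<lambda>z. slash A z ^ 4) \<longlongrightarrow> 0 ^ 4) (filtercomap Im at_top)"
    by (intro tendsto_power slash_tendsto A)
  then have lim: "((\<lambda>z. slash A z ^ 4) \<longlongrightarrow> 0) (filtercomap Im at_top)" by simp
  have "slash A (z + real N * of_int m) ^ 4 = slash A z ^ 4" if "Im z > 0" for z m
    using slash_pow4_periodic[OF A that, of m] by simp
  from periodic_exp_decay[OF hol4 _ this lim] N_pos
  obtain C Y where C: "C \<ge> 0" "\<And>z. Im z \<ge> Y \<Longrightarrow> norm (slash A z ^ 4) \<le> C * exp (- 2 * pi / real N * Im z)"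
    by auto
  show thesis
  proof (rule that[of "root 4 C" Y])
    fix z assume "Im z \<ge> Y"
    have "norm (slash A z) = root 4 (norm (slash A z ^ 4))"
      by (simp add: norm_power real_root_power_cancel)
    also have "\<dots> \<le> root 4 (C * exp (- 2 * pi / real N * Im z))"
      using C(2)[OF \<open>Im z \<ge> Y\<close>] by simp
    also have "\<dots> = root 4 C * root 4 (exp (- pi / (2 * real N) * Im z) ^ 4)"
      using N_pos by (simp add: real_root_mult exp_of_nat_mult[symmetric] field_simps)
    also have "\<dots> = root 4 C * exp (- pi / (2 * real N) * Im z)"
      by (subst real_root_power_cancel) auto
    finally show "norm (slash A z) \<le> root 4 C * exp (- pi / (2 * real N) * Im z)" .
  qed (use C in simp)
qed

section \<open>Fourier coefficients and their consequences for \<open>g\<close>\<close>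

definition coeff :: "nat \<Rightarrow> complex" where
  "coeff n = (if n = 0 then 0 else b n * of_real (real n powr (real k / 2 - 1 / 4)))"

lemma g_has_sum:
  assumes "Im z > 0"
  shows "((\<lambda>n. coeff n * e_fun (of_nat n * z)) has_sum g z) UNIV"
  using series[OF assms]
  by (rule has_sum_cong_neutral[THEN iffD1, rotated 3]) (auto simp: coeff_def)

lemma e_fun_power: "e_fun (of_nat n * z) = e_fun z ^ n"
  by (simp add: e_fun_def exp_of_nat_mult[symmetric] mult_ac)

lemma norm_e_fun: "norm (e_fun z) = exp (- 2 * pi * Im z)"
  by (simp add: e_fun_def)

lemma g_sums:
  assumes "Im z > 0"
  shows "(\<lambda>n. coeff n * e_fun z ^ n) sums g z"
  using has_sum_imp_sums[OF g_has_sum[OF assms]] by (simp only: e_fun_power)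

text \<open>Cauchy's inequality for the power series in \<open>e_fun z\<close>: the line
  \<open>Im z = y\<close> covers the circle of radius \<open>exp (- 2 * pi * y)\<close>.\<close>

lemma coeff_le:
  assumes y: "y > 0" and M: "\<And>z. Im z = y \<Longrightarrow> norm (g z) \<le> M"
  shows "norm (coeff n) \<le> M * exp (2 * pi * real n * y)"
proof -
  define F where "F = Abs_fps coeff"
  have surj: "\<exists>z. Im z = - ln (norm w) / (2 * pi) \<and> e_fun z = w" if "w \<noteq> 0" for w :: complex
  proof (intro exI conjI)
    show "Im (Ln w / (2 * of_real pi * \<i>)) = - ln (norm w) / (2 * pi)"
      using that by (simp add: Im_divide power2_eq_square)
    show "e_fun (Ln w / (2 * of_real pi * \<i>)) = w"
      using that by (simp add: e_fun_def)
  qed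
  have rad: "fps_conv_radius F \<ge> 1"
  proof -
    have "conv_radius coeff \<ge> 1"
    proof (rule conv_radius_geI_ex')
      fix r :: real assume r: "0 < r" "ereal r < 1"
      obtain z where "Im z = - ln (norm (complex_of_real r)) / (2 * pi)" "e_fun z = of_real r"
        using surj[of "of_real r"] r by auto
      moreover have "ln r < 0" using r by simp
      ultimately have "Im z > 0" "e_fun z = of_real r" using r by (auto simp: divide_neg_pos)
      then show "summable (\<lambda>n. coeff n * of_real r ^ n)"
        using g_sums[of z] by (auto simp: sums_iff)
    qed
    then show ?thesis by (simp add: F_def fps_conv_radius_def)
  qed
  define r where "r = exp (- 2 * pi * y)"
  have r: "0 < r" "r < 1" using y by (auto simp: r_def)
  have sub: "cball (0 :: complex) r \<subseteq> eball 0 (fps_conv_radius F)"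
    proof
    fix x :: complex assume "x \<in> cball 0 r"
    then have "ereal (dist 0 x) < 1" using r by simp
    then show "x \<in> eball 0 (fps_conv_radius F)"
      using rad unfolding in_eball_iff by (rule order.strict_trans2)
  qed
  have holF: "eval_fps F holomorphic_on cball 0 r"
    using sub by (intro holomorphic_on_eval_fps) auto
  have "norm ((deriv ^^ n) (eval_fps F) 0) \<le> fact n * M / r ^ n"
  proof (rule Cauchy_inequality)
    show "eval_fps F holomorphic_on ball 0 r"
      using holF by (rule holomorphic_on_subset) auto
    show "continuous_on (cball 0 r) (eval_fps F)"
      using holF by (rule holomorphic_on_imp_continuous_on)
    fix w :: complex assume w: "norm (0 - w) = r"
    then have "w \<noteq> 0" using r by auto
    then obtain z where z: "Im z = - ln (norm w) / (2 * pi)" "e_fun z = w" using surj by blast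
    then have "Im z = y" using w by (simp add: r_def)
    have "eval_fps F w = g z"
      using g_sums[of z] z(2) y \<open>Im z = y\<close> by (simp add: eval_fps_def F_def sums_iff)
    then show "norm (eval_fps F w) \<le> M" using M[OF \<open>Im z = y\<close>] by simp
  qed (use r in auto)
  moreover have "(deriv ^^ n) (eval_fps F) 0 = fact n * coeff n"
    using fps_nth_conv_deriv[of F n] rad by (simp add: F_def order.strict_trans2[of 0 1])
  ultimately have "norm (coeff n) \<le> M / r ^ n"
    by (simp add: norm_mult mult_le_cancel_left_pos flip: times_divide_eq_right)
  also have "\<dots> = M * exp (2 * pi * real n * y)"
    by (simp add: r_def exp_of_nat_mult[symmetric] exp_minus field_simps)
  finally show ?thesis .
qed

text \<open>Hecke's choice \<open>y = 1 / n\<close> in \<open>coeff_le\<close> keeps the exponential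
  factor equal to \<open>exp (2 * pi)\<close>, while \<open>moderate_growth\<close> stays polynomial
  in \<open>n\<close>.\<close>

lemma coeff_poly_bound:
  obtains M where "M \<ge> 0" and "\<And>n. norm (coeff n) \<le> M * (1 + real n) ^ (k + 1)"
proof -
  obtain M where M: "M \<ge> 0" "\<And>z. Im z > 0 \<Longrightarrow> norm (g z) \<le> M * (1 + 1 / Im z) ^ (k + 1)"
    using moderate_growth by blast
  show thesis
  proof (rule that[of "M * exp (2 * pi)"])
    fix n
    show "norm (coeff n) \<le> M * exp (2 * pi) * (1 + real n) ^ (k + 1)"
    proof (cases "n = 0")
      case True then show ?thesis using M(1) by (simp add: coeff_def)
    next
      case False
      have "norm (g z) \<le> M * (1 + real n) ^ (k + 1)" if "Im z = 1 / real n" for z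
        using M(2)[of z] that False by simp
      then have "norm (coeff n) \<le> M * (1 + real n) ^ (k + 1) * exp (2 * pi * real n * (1 / real n))"
        by (intro coeff_le) (use False in auto)
      then show ?thesis using False by (simp add: mult_ac)
    qed
  qed (use M in simp)
qed

text \<open>Between height \<open>y\<close> and height \<open>Im z\<close> each term with
  \<open>n \<ge> 1\<close> shrinks at least by \<open>exp (- 2 * pi * (Im z - y))\<close>. Unlike
  \<open>slash_exp_decay\<close>, this holds from any positive height on;
  \<open>G_rapid_decay\<close> uses it from \<open>cos \<theta> / q\<close>.\<close>

lemma g_exp_decay:
  assumes y: "y > 0"
  obtains C where "C \<ge> 0" and "\<And>z. Im z \<ge> y \<Longrightarrow> norm (g z) \<le> C * exp (- 2 * pi * Im z)"
proof -
  define f where "f = (\<lambda>n. norm (coeff n) * exp (- 2 * pi * y) ^ n)"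
  have "(\<lambda>n. coeff n * e_fun (of_nat n * (\<i> * y))) summable_on UNIV"
    using g_has_sum[of "\<i> * y"] y by (auto intro: has_sum_imp_summable)
  then have "(\<lambda>n. norm (coeff n * e_fun (of_nat n * (\<i> * y)))) summable_on UNIV"
    by (simp add: summable_on_iff_abs_summable_on_complex)
  then have f: "(f has_sum infsum f UNIV) UNIV"
    by (simp add: f_def e_fun_power norm_mult norm_power norm_e_fun has_sum_infsum)
  have S0: "infsum f UNIV \<ge> 0" by (rule infsum_nonneg) (simp add: f_def)
  show thesis
  proof (rule that[of "infsum f UNIV * exp (2 * pi * y)"])
    fix z assume z: "Im z \<ge> y"
    have fs: "((\<lambda>n. f n * exp (- 2 * pi * (Im z - y))) has_sum infsum f UNIV * exp (- 2 * pi * (Im z - y))) UNIV"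
      by (rule has_sum_cmult_left[OF f])
    have le: "norm (coeff n * e_fun (of_nat n * z)) \<le> f n * exp (- 2 * pi * (Im z - y))" for n
    proof (cases "n = 0")
      case True
      then show ?thesis by (simp add: coeff_def f_def)
    next
      case False
      have "exp (- 2 * pi * Im z) ^ n = exp (- 2 * pi * y) ^ n * exp (- 2 * pi * (Im z - y)) ^ n"
        by (simp add: power_mult_distrib[symmetric] exp_add[symmetric] algebra_simps)
      also have "\<dots> \<le> exp (- 2 * pi * y) ^ n * exp (- 2 * pi * (Im z - y)) ^ 1"
        using z False by (intro mult_left_mono power_decreasing) auto
      finally show ?thesis
        by (simp add: f_def e_fun_power norm_mult norm_power norm_e_fun mult.assoc mult_left_mono)
    qed
    have "Im z > 0" using z y by simp
    then have "norm (g z) \<le> infsum f UNIV * exp (- 2 * pi * (Im z - y))"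
      by (rule norm_infsum_le[OF g_has_sum fs le])
    also have "\<dots> = infsum f UNIV * exp (2 * pi * y) * exp (- 2 * pi * Im z)"
      by (simp add: exp_add[symmetric] algebra_simps)
    finally show "norm (g z) \<le> infsum f UNIV * exp (2 * pi * y) * exp (- 2 * pi * Im z)" .
  qed (use S0 in simp)
qed

lemma g_periodic:
  assumes "Im z > 0"
  shows "g (z + of_int m) = g z"
proof -
  have "e_fun (z + of_int m) = e_fun z"
    by (simp add: e_fun_def ring_distribs exp_add exp_integer_2pi[of "of_int m"] mult_ac)
  then show ?thesis
    using g_sums[OF assms] g_sums[of "z + of_int m"] assms by (simp add: sums_iff)
qed

lemma g_reflect:
  assumes "\<forall>j\<ge>1. b j \<in> \<real>" and "Im z > 0"
  shows "g (- cnj z) = cnj (g z)"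
proof -
  have "cnj (coeff n) = coeff n" for n
    using assms(1) by (auto simp: coeff_def Reals_cnj_iff)
  moreover have "cnj (e_fun z) = e_fun (- cnj z)"
    by (simp add: e_fun_def exp_cnj)
  ultimately have "(\<lambda>n. coeff n * e_fun (- cnj z) ^ n) sums cnj (g z)"
    using sums_cnj[THEN iffD2, OF g_sums[OF assms(2)]] by simp
  then show ?thesis
    using g_sums[of "- cnj z"] assms(2) by (simp add: sums_iff)
qed

lemma g_nonzero:
  assumes "b 1 \<noteq> 0"
  obtains z where "Im z > 0" and "g z \<noteq> 0"
proof (rule ccontr)
  assume "\<not> thesis"
  then have "\<And>z. Im z > 0 \<Longrightarrow> g z = 0" using that by blast
  then have "norm (coeff 1) \<le> 0 * exp (2 * pi * real 1 * 1)"
    by (intro coeff_le) auto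
  then show False using assms by (simp add: coeff_def)
qed

end

subsection \<open>The gamma integral in logarithmic coordinates\<close>

text \<open>Replace \<open>exp u\<close> by its lower bound \<open>u^2 / 2\<close> and complete the
  square.\<close>

lemma exp_minus_exp_le:
  fixes B c u :: real
  assumes "c > 0" and "u \<ge> 0"
  shows "exp (B * u - c * exp u) \<le> exp (B\<^sup>2 / (2 * c))"
proof -
  have "u\<^sup>2 / 2 \<le> exp u"
    using exp_lower_Taylor_quadratic[OF assms(2)] assms(2) by linarith
  then have "c * (u\<^sup>2 / 2) \<le> c * exp u" using assms(1) by (intro mult_left_mono) auto
  moreover have "B * u - c * (u\<^sup>2 / 2) \<le> B\<^sup>2 / (2 * c)"
  proof -
    have "0 \<le> (B - c * u)\<^sup>2 / (2 * c)" using assms(1) by simp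
    also have "\<dots> = B\<^sup>2 / (2 * c) - (B * u - c * (u\<^sup>2 / 2))"
      using assms(1) by (simp add: power2_eq_square field_simps)
    finally show ?thesis by simp
  qed
  ultimately show ?thesis by simp
qed

lemma poly_times_exp_bounded:
  fixes \<alpha> :: real
  assumes "\<alpha> > 0"
  obtains K where "\<And>x. x \<ge> 0 \<Longrightarrow> (1 + x) ^ m * exp (- \<alpha> * x) \<le> K"
proof (rule that)
  fix x :: real assume x: "x \<ge> 0"
  have nn: "0 \<le> \<alpha> * (1 + x)" using assms x by simp
  \<comment> \<open>A single term of the exponential series is at most its sum.\<close>
  have "(\<alpha> * (1 + x)) ^ m /\<^sub>R fact m \<le> (\<Sum>n. (\<alpha> * (1 + x)) ^ n /\<^sub>R fact n)"
    using sum_le_suminf[OF summable_exp_generic[of "\<alpha> * (1 + x)"], of "{m}"] nn by simp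
  then have "(\<alpha> * (1 + x)) ^ m \<le> fact m * exp (\<alpha> * (1 + x))"
    by (simp add: exp_def field_simps)
  then have "(1 + x) ^ m \<le> fact m * exp (\<alpha> * (1 + x)) / \<alpha> ^ m"
    using assms unfolding power_mult_distrib by (simp add: pos_le_divide_eq mult.commute)
  then have "(1 + x) ^ m * exp (- \<alpha> * x) \<le> fact m * exp (\<alpha> * (1 + x)) / \<alpha> ^ m * exp (- \<alpha> * x)"
    by (rule mult_right_mono) simp
  also have "\<dots> = fact m * exp \<alpha> / \<alpha> ^ m"
    by (simp add: exp_add[symmetric] algebra_simps)
  finally show "(1 + x) ^ m * exp (- \<alpha> * x) \<le> fact m * exp \<alpha> / \<alpha> ^ m" .
qed

lemma integrable_exp_gamma:
  assumes "Re s > 0"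
  shows "integrable lborel (\<lambda>u. exp (s * complex_of_real u) * complex_of_real (exp (- exp u)))"
proof (rule Bochner_Integration.integrable_bound)
  define K where "K = exp ((2 * Re s)\<^sup>2 / (2 * 1))"
  have "integrable lborel (\<lambda>u. exp (- \<bar>0 + Re s * u\<bar>))"
    by (rule lborel_integrable_real_affine[OF integrable_exp_minus_abs]) (use assms in simp)
  then show "integrable lborel (\<lambda>u. K * exp (- (Re s * \<bar>u\<bar>)))"
    using assms by (simp add: abs_mult)
  have K: "K \<ge> 1" by (simp add: K_def)
  have "exp (Re s * u) * exp (- exp u) \<le> K * exp (- (Re s * \<bar>u\<bar>))" for u
  proof (cases "u \<ge> 0")
    case True
    have "exp (Re s * u) * exp (- exp u) = exp (2 * Re s * u - 1 * exp u) * exp (- (Re s * \<bar>u\<bar>))"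
      using True by (simp add: exp_add[symmetric] algebra_simps)
    also have "\<dots> \<le> K * exp (- (Re s * \<bar>u\<bar>))"
      unfolding K_def using True by (intro mult_right_mono exp_minus_exp_le) auto
    finally show ?thesis .
  next
    case False
    have "exp (Re s * u) * exp (- exp u) \<le> exp (Re s * u) * 1" by (intro mult_left_mono) auto
    also have "\<dots> \<le> K * exp (- (Re s * \<bar>u\<bar>))"
      using False K mult_right_mono[OF K, of "exp (Re s * u)"] by simp
    finally show ?thesis .
  qed
  then show "AE u in lborel. norm (exp (s * complex_of_real u) * complex_of_real (exp (- exp u))) \<le> norm (K * exp (- (Re s * \<bar>u\<bar>)))"
    using K by (intro AE_I2) (simp add: norm_mult)
qed measurable

text \<open>Euler's integral after the substitution \<open>t = exp u\<close>.\<close>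

lemma integral_exp_gamma:
  assumes s: "Re s > 0"
  shows "(LINT u|lborel. exp (s * complex_of_real u) * complex_of_real (exp (- exp u))) = Gamma s"
proof -
  define f where "f = (\<lambda>t. complex_of_real t powr (s - 1) / of_real (exp t))"
  have eq: "exp u *\<^sub>R f (exp u) = exp (s * complex_of_real u) * complex_of_real (exp (- exp u))" for u
  proof -
    have "complex_of_real (exp u) powr (s - 1) = exp ((s - 1) * complex_of_real u)"
      by (simp add: powr_def Ln_of_real)
    then have "exp u *\<^sub>R f (exp u) = exp (complex_of_real u) * exp ((s - 1) * complex_of_real u) / of_real (exp (exp u))"
      by (simp add: f_def scaleR_conv_of_real exp_of_real)
    also have "exp (complex_of_real u) * exp ((s - 1) * complex_of_real u) = exp (s * complex_of_real u)"
      by (simp add: exp_add[symmetric] algebra_simps)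
    finally show ?thesis by (simp add: exp_minus divide_inverse of_real_inverse)
  qed
  have "f absolutely_integrable_on {0<..}"
    unfolding f_def using absolutely_integrable_Gamma_integral'[OF s] .
  then have int0: "set_integrable lborel {0<..} f"
  proof -
    assume "f absolutely_integrable_on {0<..}"
    moreover have "(\<lambda>x. indicator {0<..} x *\<^sub>R f x) \<in> borel_measurable lborel"
      unfolding f_def by measurable
    ultimately show ?thesis
      unfolding set_integrable_def by (simp add: integrable_completion)
  qed
  have "(LBINT x=0..\<infinity>. f x) = (LBINT u=-\<infinity>..\<infinity>. exp u *\<^sub>R f (exp u))"
  proof (rule interval_integral_substitution_integrable)
    show "isCont f (exp x)" for x
      unfolding f_def by (intro continuous_intros) (auto simp: complex_nonpos_Reals_iff)
    show "((ereal \<circ> exp \<circ> real_of_ereal) \<longlongrightarrow> 0) (at_right (- \<infinity>))"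
      unfolding zero_ereal_def by (auto simp: ereal_tendsto_simps intro: exp_at_bot)
    show "((ereal \<circ> exp \<circ> real_of_ereal) \<longlongrightarrow> \<infinity>) (at_left \<infinity>)"
      by (auto simp: ereal_tendsto_simps intro: exp_at_top)
    show "set_integrable lborel (einterval (- \<infinity>) \<infinity>) (\<lambda>x. exp x *\<^sub>R f (exp x))"
      unfolding eq using integrable_exp_gamma[OF s] by (simp add: set_integrable_def)
    show "set_integrable lborel (einterval 0 \<infinity>) f"
      using int0 by (simp add: einterval_def greaterThan_def)
  qed (auto intro!: derivative_eq_intros)
  also have "\<dots> = (LINT u|lborel. exp (s * complex_of_real u) * complex_of_real (exp (- exp u)))"
    unfolding eq by (simp add: interval_lebesgue_integral_def set_lebesgue_integral_def)
  also have "(LBINT x=0..\<infinity>. f x) = integral {0<..} f"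
    using set_borel_integral_eq_integral(2)[OF int0]
    by (simp add: interval_lebesgue_integral_def einterval_def greaterThan_def)
  also have "\<dots> = integral {0..} f"
    by (rule integral_spike_set) (auto intro: negligible_subset[of "{0}"])
  also have "\<dots> = Gamma s"
    unfolding f_def using Gamma_integral_complex[OF s] by (rule integral_unique)
  finally show ?thesis ..
qed

lemma gamma_integral_scaled:
  assumes s: "Re s > 0" and c: "c > 0"
  shows "integrable lborel (\<lambda>u. exp (s * complex_of_real u) * complex_of_real (exp (- c * exp u)))"
    and "(LINT u|lborel. exp (s * complex_of_real u) * complex_of_real (exp (- c * exp u))) =
      Gamma s * complex_of_real c powr (- s)"
proof -
  define F where "F = (\<lambda>u. exp (s * complex_of_real u) * complex_of_real (exp (- exp u)))"
  have F: "exp (s * complex_of_real u) * complex_of_real (exp (- c * exp u)) = F (ln c + 1 * u) * complex_of_real c powr (- s)" for u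
  proof -
    have "complex_of_real c powr (- s) = exp (- s * complex_of_real (ln c))"
      using c by (simp add: powr_def Ln_of_real)
    moreover have "exp (s * complex_of_real u) = exp (s * complex_of_real (ln c + 1 * u)) * exp (- s * complex_of_real (ln c))"
      by (simp add: exp_add[symmetric] algebra_simps)
    ultimately show ?thesis using c by (simp add: F_def exp_add)
  qed
  show "integrable lborel (\<lambda>u. exp (s * complex_of_real u) * complex_of_real (exp (- c * exp u)))"
    unfolding F using lborel_integrable_real_affine[OF integrable_exp_gamma[OF s], of 1 "ln c"]
    by (simp add: F_def)
  have "(LINT u|lborel. F (ln c + 1 * u)) = Gamma s"
    using lborel_integral_real_affine[of 1 F "ln c"] integral_exp_gamma[OF s] by (simp add: F_def)
  then show "(LINT u|lborel. exp (s * complex_of_real u) * complex_of_real (exp (- c * exp u))) =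
      Gamma s * complex_of_real c powr (- s)"
    unfolding F by simp
qed

text \<open>Taking absolute values replaces \<open>s\<close> by \<open>Re s\<close>. This supplies
  the absolute convergence for integrating term by term in \<open>L_series\<close>.\<close>

lemma gamma_integral_norm:
  assumes s: "Re s > 0" and c: "c > 0"
  shows "(LINT u|lborel. norm (exp (s * complex_of_real u) * complex_of_real (exp (- c * exp u)))) =
      Gamma (Re s) * c powr (- Re s)"
proof -
  have e: "exp (complex_of_real (Re s) * complex_of_real u) = complex_of_real (exp (Re s * u))" for u
    by (simp flip: exp_of_real)
  have "complex_of_real (LINT u|lborel. norm (exp (s * complex_of_real u) * complex_of_real (exp (- c * exp u)))) =
     (LINT u|lborel. exp (complex_of_real (Re s) * complex_of_real u) * complex_of_real (exp (- c * exp u)))"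
    unfolding integral_complex_of_real[symmetric]
    unfolding e by (simp add: norm_mult)
  also have "\<dots> = complex_of_real (Gamma (Re s) * c powr (- Re s))"
    using gamma_integral_scaled(2)[of "complex_of_real (Re s)" c] s c
    by (simp add: Gamma_complex_of_real powr_of_real[symmetric])
  finally show ?thesis by (simp only: of_real_eq_iff)
qed

subsection \<open>The twisted L-function\<close>

locale twisted_form = half_integral_form +
  fixes p q \<beta> :: int
  assumes q_pos: "q > 0" and N_dvd: "int N dvd q" and p_sq: "p * p - \<beta> * q = 1"
    and b_real: "\<forall>j\<ge>1. b j \<in> \<real>" and b1: "b 1 \<noteq> 0"
begin

section \<open>The form along the vertical line above \<open>p / q\<close>\<close>

definition pt :: "complex \<Rightarrow> complex" where
  "pt w = of_int p / of_int q + \<i> * exp w / of_int q"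

text \<open>The exponent is half the weight \<open>k + 1/2\<close>, so that the automorphy factor,
  of modulus \<open>exp ((k + 1/2) * Re w)\<close>, is shared equally between \<open>w\<close> and
  \<open>- w\<close>. The scale \<open>1 / q\<close> in \<open>pt\<close> puts the centre of this
  symmetry at \<open>w = 0\<close>.\<close>

definition G :: "complex \<Rightarrow> complex" where
  "G w = exp (of_real (real (2 * k + 1) / 4) * w) * g (pt w)"

lemma Im_pt: "Im (pt w) = exp (Re w) * cos (Im w) / of_int q"
  by (simp add: pt_def Re_exp Im_divide power2_eq_square)

lemma cos_pos_strip: "w \<in> strip \<Longrightarrow> cos (Im w) > 0"
  by (auto simp: strip_def abs_less_iff intro!: cos_gt_zero_pi)

lemma Im_pt_pos: "w \<in> strip \<Longrightarrow> Im (pt w) > 0"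
  using q_pos cos_pos_strip by (simp add: Im_pt)

lemma G_hol: "G holomorphic_on strip"
proof -
  have "pt holomorphic_on strip"
    unfolding pt_def using q_pos by (intro holomorphic_intros) auto
  then have "(g \<circ> pt) holomorphic_on strip"
    by (rule holomorphic_on_compose_gen[OF _ hol]) (use Im_pt_pos in auto)
  then show ?thesis
    unfolding G_def by (intro holomorphic_intros) (simp add: o_def)
qed

definition \<gamma> :: "int^2^2" where "\<gamma> = mat2 p \<beta> q p"

lemma \<gamma>_Gamma0: "\<gamma> \<in> Gamma0 N"
  using p_sq N_dvd by (simp add: \<gamma>_def Gamma0_def SL2Z_iff)

definition \<omega> :: complex where
  "\<omega> = mult_fac \<gamma> * exp (\<i> * of_real (pi / 4)) ^ (2 * k + 1)"

lemma norm_\<omega>: "norm \<omega> = 1"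
  by (simp add: \<omega>_def norm_mult norm_power norm_mult_fac[OF \<gamma>_Gamma0])

text \<open>As both diagonal entries of \<open>\<gamma>\<close> are \<open>p\<close>, it sends the
  line above \<open>- p / q\<close> to the line above \<open>p / q\<close> and inverts its
  parameter. Real coefficients identify \<open>g\<close> on the line above \<open>- p / q\<close>
  with its conjugate on the line above \<open>p / q\<close>.\<close>

lemma G_reflect:
  assumes w: "w \<in> strip"
  shows "G (- w) = \<omega> * cnj (G (cnj w))"
proof -
  define z where "z = - of_int p / of_int q + \<i> * exp w / of_int q"
  have q0: "complex_of_int q \<noteq> 0" using q_pos by simp
  have Imz: "Im z > 0"
    using Im_pt_pos[OF w] by (simp add: z_def pt_def)
  have den: "auto_denom \<gamma> z = \<i> * exp w"
    using q0 by (simp add: auto_denom_def \<gamma>_def z_def field_simps)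
  have "complex_of_int p * of_int p - of_int \<beta> * of_int q = 1"
    using p_sq by (metis of_int_1 of_int_diff of_int_mult)
  then have num: "of_int p * z + of_int \<beta> = (\<i> * exp w * of_int p - 1) / of_int q"
    using q0 by (simp add: z_def field_simps)
  have mo: "moebius \<gamma> z = pt (- w)"
  proof -
    have "moebius \<gamma> z = (\<i> * exp w * of_int p - 1) / of_int q / (\<i> * exp w)"
      unfolding moebius_def den using num by (simp add: \<gamma>_def)
    also have "\<dots> = pt (- w)"
      using q0 by (simp add: pt_def exp_minus field_simps)
    finally show ?thesis .
  qed
  \<comment> \<open>On the strip the argument \<open>pi / 4 + Im w / 2\<close> lies strictly between
    0 and \<open>pi / 2\<close>, so this root has positive real part and is the principal
    one.\<close>
  have cs: "csqrt (\<i> * exp w) = exp (\<i> * of_real (pi / 4)) * exp (w / 2)"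
  proof (rule csqrt_unique)
    have "(exp (\<i> * of_real (pi / 4)) * exp (w / 2))\<^sup>2 = exp (\<i> * of_real (pi / 2) + w)"
      by (simp add: power2_eq_square exp_add[symmetric])
    also have "\<dots> = \<i> * exp w" by (simp only: exp_add cis_conv_exp[symmetric] cis_pi_half)
    finally show "(exp (\<i> * of_real (pi / 4)) * exp (w / 2))\<^sup>2 = \<i> * exp w" .
    have "0 < Re (exp (\<i> * of_real (pi / 4) + w / 2))"
      unfolding Re_exp using w by (auto simp: strip_def abs_less_iff intro!: mult_pos_pos cos_gt_zero_pi)
    then show "0 < Re (exp (\<i> * of_real (pi / 4)) * exp (w / 2)) \<or>
        Re (exp (\<i> * of_real (pi / 4)) * exp (w / 2)) = 0 \<and> 0 \<le> Im (exp (\<i> * of_real (pi / 4)) * exp (w / 2))"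
      by (simp add: exp_add)
  qed
  have "- cnj z = pt (cnj w)"
    by (simp add: z_def pt_def exp_cnj)
  then have gz: "g z = cnj (g (pt (cnj w)))"
    using g_reflect[OF b_real Imz] by (metis complex_cnj_cnj)
  have "g (pt (- w)) = mult_fac \<gamma> * wt k (\<i> * exp w) * g z"
    using transform[OF \<gamma>_Gamma0 Imz] by (simp only: mo den)
  also have "\<dots> = \<omega> * (exp (w / 2) ^ (2 * k + 1) * g z)"
    unfolding wt_def cs \<omega>_def power_mult_distrib by (simp only: mult_ac)
  also have "exp (w / 2) ^ (2 * k + 1) = exp (of_real (real (2 * k + 1) / 2) * w)"
    unfolding exp_of_nat_mult[symmetric] by (simp add: field_simps)
  finally have "G (- w) = \<omega> * ((exp (of_real (real (2 * k + 1) / 4) * (- w)) * exp (of_real (real (2 * k + 1) / 2) * w)) * g z)"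
    by (simp only: G_def mult_ac)
  also have "exp (of_real (real (2 * k + 1) / 4) * (- w)) * exp (of_real (real (2 * k + 1) / 2) * w) =
      cnj (exp (of_real (real (2 * k + 1) / 4) * cnj w))"
    unfolding exp_cnj exp_add[symmetric] by (rule arg_cong[of _ _ exp]) (simp add: complex_eq_iff field_simps)
  finally show ?thesis
    unfolding gz G_def by simp
qed

text \<open>For \<open>Re w \<ge> 0\<close> the height of \<open>pt w\<close> is at least
  \<open>c * exp (Re w)\<close>, so the decay is doubly exponential. The other half follows from the
  reflection.\<close>

lemma G_rapid_decay: "rapid_decay G"
  unfolding rapid_decay_def
proof (intro allI impI)
  fix \<theta> A :: real assume \<theta>: "0 \<le> \<theta> \<and> \<theta> < pi / 2"
  define c where "c = cos \<theta> / of_int q"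
  have c0: "c > 0" using q_pos \<theta> by (auto simp: c_def intro!: divide_pos_pos cos_gt_zero_pi)
  obtain C where C: "C \<ge> 0" "\<And>z. Im z \<ge> c \<Longrightarrow> norm (g z) \<le> C * exp (- 2 * pi * Im z)"
    using g_exp_decay[OF c0] by blast
  define \<kappa> where "\<kappa> = real (2 * k + 1) / 4"
  define K where "K = C * exp ((\<kappa> + A)\<^sup>2 / (2 * (2 * pi * c)))"
  have right: "norm (G w) \<le> K * exp (- A * \<bar>Re w\<bar>)" if w: "\<bar>Im w\<bar> \<le> \<theta>" "Re w \<ge> 0" for w
  proof -
    have "cos \<theta> \<le> cos \<bar>Im w\<bar>" using w \<theta> pi_gt_zero by (intro cos_monotone_0_pi_le) auto
    then have "cos \<theta> \<le> cos (Im w)" by simp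
    then have Im: "c * exp (Re w) \<le> Im (pt w)"
      unfolding Im_pt c_def using q_pos by (simp add: field_simps)
    moreover have "c \<le> c * exp (Re w)" using w c0 by simp
    ultimately have "norm (g (pt w)) \<le> C * exp (- 2 * pi * Im (pt w))" by (intro C(2)) linarith
    also have "\<dots> \<le> C * exp (- 2 * pi * (c * exp (Re w)))"
      using Im C(1) by (intro mult_left_mono) auto
    finally have "norm (G w) \<le> exp (\<kappa> * Re w) * (C * exp (- 2 * pi * (c * exp (Re w))))"
      unfolding G_def norm_mult by (intro mult_mono) (auto simp: \<kappa>_def)
    also have "\<dots> = C * exp ((\<kappa> + A) * Re w - (2 * pi * c) * exp (Re w)) * exp (- A * Re w)"
      by (simp add: exp_add[symmetric] algebra_simps)
    also have "\<dots> \<le> C * exp ((\<kappa> + A)\<^sup>2 / (2 * (2 * pi * c))) * exp (- A * Re w)"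
      using w c0 C(1) by (intro mult_right_mono mult_left_mono exp_minus_exp_le) auto
    finally show ?thesis using w by (simp add: K_def)
  qed
  have "norm (G w) \<le> K * exp (- A * \<bar>Re w\<bar>)" if w: "\<bar>Im w\<bar> \<le> \<theta>" for w
  proof (cases "Re w \<ge> 0")
    case False
    have "norm (G w) = norm (G (- cnj w))"
      using G_reflect[of "- w"] w \<theta> by (simp add: strip_def norm_mult norm_\<omega>)
    also have "\<dots> \<le> K * exp (- A * \<bar>Re (- cnj w)\<bar>)" by (rule right) (use w False in auto)
    finally show ?thesis by simp
  qed (use right w in simp)
  then show "\<exists>C. \<forall>w. \<bar>Im w\<bar> \<le> \<theta> \<longrightarrow> norm (G w) \<le> C * exp (- A * \<bar>Re w\<bar>)" by blast
qed

text \<open>The normalisation makes the transform of \<open>h\<close> real on the imaginary axis.\<close>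

definition h :: "complex \<Rightarrow> complex" where "h w = G w / csqrt \<omega>"

lemma norm_h: "norm (h w) = norm (G w)"
  by (simp add: h_def norm_divide norm_\<omega>)

lemma \<omega>_nz: "\<omega> \<noteq> 0" using norm_\<omega> by auto

lemma h_hol: "h holomorphic_on strip"
  unfolding h_def by (intro holomorphic_intros G_hol) (simp add: \<omega>_nz)

lemma h_rapid_decay: "rapid_decay h"
  using G_rapid_decay by (simp add: rapid_decay_def norm_h)

text \<open>A square root of a unimodular number satisfies
  \<open>\<omega> * cnj (csqrt \<omega>) = csqrt \<omega>\<close>, so division by it absorbs
  \<omega> into the conjugation.\<close>

lemma h_reflect: "h (- complex_of_real u) = cnj (h (complex_of_real u))"
proof -
  have "csqrt \<omega> * cnj (csqrt \<omega>) = 1"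
    by (simp add: complex_norm_square[symmetric] norm_\<omega>)
  moreover have "csqrt \<omega> * csqrt \<omega> = \<omega>"
    by (metis power2_csqrt power2_eq_square)
  ultimately have "\<omega> * cnj (csqrt \<omega>) = csqrt \<omega>"
    by (metis mult.assoc mult.right_neutral)
  moreover have "G (- complex_of_real u) = \<omega> * cnj (G (complex_of_real u))"
    using G_reflect[of "complex_of_real u"] by (simp add: strip_def)
  ultimately show ?thesis
    using \<omega>_nz by (simp add: h_def field_simps)
qed

lemma mellin_h_real: "mellin h (\<i> * complex_of_real t) \<in> \<real>"
proof -
  define f where "f = (\<lambda>u. h (complex_of_real u) * exp (\<i> * complex_of_real t * complex_of_real u))"
  have "cnj (f u) = f (0 + (-1) * u)" for u
    using h_reflect[of u] by (simp add: f_def exp_cnj)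
  moreover have "cnj (mellin h (\<i> * complex_of_real t)) = (LINT u|lborel. cnj (f u))"
    using Bochner_Integration.integral_cnj[of lborel f] by (simp only: mellin_def f_def)
  ultimately have "cnj (mellin h (\<i> * complex_of_real t)) = (LINT u|lborel. f (0 + (-1) * u))"
    by simp
  also have "\<dots> = mellin h (\<i> * complex_of_real t)"
    using lborel_integral_real_affine[of "-1" f 0] by (simp add: mellin_def f_def)
  finally show ?thesis by (simp add: Reals_cnj_iff)
qed

section \<open>The continued L-function\<close>

definition expo :: "complex \<Rightarrow> complex" where
  "expo s = s + of_real (real k / 2 - 1 / 4)"

text \<open>The completed L-function divided by its gamma factor; using the entire
  \<open>rGamma\<close> avoids poles. Since \<open>expo s = (s - 1/2) + (2 * k + 1) / 4\<close>, the
  exponent in \<open>G\<close> leaves \<open>s - 1/2\<close> for the transform, and the critical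
  line becomes the imaginary axis.\<close>

definition L :: "complex \<Rightarrow> complex" where
  "L s = mellin G (s - 1 / 2) * rGamma (expo s) * of_real (2 * pi / real_of_int q) powr expo s"

lemma L_entire: "L holomorphic_on UNIV"
proof -
  have "(mellin G \<circ> (\<lambda>s. s - 1 / 2)) holomorphic_on UNIV"
    by (intro holomorphic_on_compose holomorphic_on_subset[OF mellin_entire[OF G_hol G_rapid_decay]] holomorphic_intros) auto
  then show ?thesis
    unfolding L_def expo_def using q_pos
    by (intro holomorphic_intros) (auto simp: o_def)
qed

lemma G_series:
  "(\<lambda>n. coeff n * e_fun (of_nat n * of_real (of_int p / of_int q)) *
      (exp (expo s * complex_of_real u) * complex_of_real (exp (- (2 * pi * real n / real_of_int q) * exp u))))
     sums (G (complex_of_real u) * exp ((s - 1 / 2) * complex_of_real u))"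
proof -
  have "Im (pt (complex_of_real u)) > 0"
    by (rule Im_pt_pos) (simp add: strip_def)
  from sums_mult2[OF g_sums[OF this], of "exp (expo s * complex_of_real u)"]
  have "(\<lambda>n. coeff n * e_fun (pt (complex_of_real u)) ^ n * exp (expo s * complex_of_real u)) sums
      (g (pt (complex_of_real u)) * exp (expo s * complex_of_real u))" .
  moreover have "e_fun (pt (complex_of_real u)) ^ n = e_fun (of_nat n * of_real (of_int p / of_int q)) *
      complex_of_real (exp (- (2 * pi * real n / real_of_int q) * exp u))" for n
  proof -
    have "2 * of_real pi * \<i> * (of_nat n * pt (complex_of_real u)) =
        2 * of_real pi * \<i> * (of_nat n * of_real (of_int p / of_int q)) +
        complex_of_real (- (2 * pi * real n / real_of_int q) * exp u)"
      using q_pos by (simp add: pt_def field_simps exp_of_real)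
    then have "e_fun (of_nat n * pt (complex_of_real u)) = e_fun (of_nat n * of_real (of_int p / of_int q)) *
      complex_of_real (exp (- (2 * pi * real n / real_of_int q) * exp u))"
      by (simp only: e_fun_def exp_of_real[symmetric] exp_add)
    then show ?thesis by (simp only: e_fun_power)
  qed
  moreover have "g (pt (complex_of_real u)) * exp (expo s * complex_of_real u) =
      G (complex_of_real u) * exp ((s - 1 / 2) * complex_of_real u)"
  proof -
    have "expo s * complex_of_real u = of_real (real (2 * k + 1) / 4) * complex_of_real u + (s - 1 / 2) * complex_of_real u"
      by (simp add: expo_def field_simps)
    then show ?thesis by (simp add: G_def exp_add)
  qed
  ultimately show ?thesis by (simp add: mult_ac)
qed

text \<open>Integrating \<open>G_series\<close> termwise yields gamma integrals, whose gamma factor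
  and power of \<open>2 * pi / q\<close> are cancelled by those in \<open>L\<close>.\<close>

lemma L_series:
  assumes s: "Re s > real k + 4"
  shows "((\<lambda>n. b n * e_fun (of_nat n * of_real (of_int p / of_int q)) * of_nat n powr (- s)) has_sum L s) {1..}"
proof -
  define \<sigma> where "\<sigma> = Re (expo s)"
  have \<sigma>: "\<sigma> > real k + 3" using s by (simp add: \<sigma>_def expo_def)
  then have \<sigma>0: "Re (expo s) > 0" by (simp add: \<sigma>_def)
  define c where "c = (\<lambda>n. 2 * pi * real n / real_of_int q)"
  have c: "c n > 0" if "n > 0" for n using q_pos that by (simp add: c_def)
  define E where "E = (\<lambda>n u. exp (expo s * complex_of_real u) * complex_of_real (exp (- c n * exp u)))"
  define a where "a = (\<lambda>n. coeff n * e_fun (of_nat n * of_real (of_int p / of_int q)))"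
  have a0: "a 0 = 0" by (simp add: a_def coeff_def)
  have norm_a: "norm (a n) = norm (coeff n)" for n
    by (simp add: a_def norm_mult norm_e_fun)
  have int: "integrable lborel (\<lambda>u. a n * E n u)" for n
    using gamma_integral_scaled(1)[OF \<sigma>0 c, of n] a0 by (cases "n = 0") (auto simp: E_def)
  have val: "(LINT u|lborel. a n * E n u) = a n * (Gamma (expo s) * complex_of_real (c n) powr (- expo s))" for n
    using gamma_integral_scaled(2)[OF \<sigma>0 c, of n] a0 by (cases "n = 0") (auto simp: E_def)
  have nval: "(LINT u|lborel. norm (a n * E n u)) = norm (coeff n) * (Gamma \<sigma> * c n powr (- \<sigma>))" for n
    using gamma_integral_norm[OF \<sigma>0 c, of n] a0 by (cases "n = 0") (auto simp: E_def norm_mult[of "a n"] norm_a \<sigma>_def coeff_def)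
  obtain M where M: "M \<ge> 0" "\<And>n. norm (coeff n) \<le> M * (1 + real n) ^ (k + 1)"
    using coeff_poly_bound by blast
  \<comment> \<open>Here \<open>coeff n\<close> is of order at most \<open>k + 1\<close> in
    \<open>n\<close>, and \<open>\<sigma> > k + 3\<close> leaves \<open>1 / n^2\<close>.\<close>
  have summ: "summable (\<lambda>n. norm (coeff n) * (Gamma \<sigma> * c n powr (- \<sigma>)))"
  proof (rule summable_comparison_test')
    define B where "B = M * 2 ^ (k + 1) * Gamma \<sigma> * (2 * pi / real_of_int q) powr (- \<sigma>)"
    have G0: "Gamma \<sigma> > 0" using \<sigma> by (intro Gamma_real_pos) simp
    show "summable (\<lambda>n. B * (1 / real n ^ 2))"
      by (intro summable_mult) (use inverse_power_summable[of 2, where ?'a = real] in \<open>simp add: inverse_eq_divide\<close>)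
    show "norm (norm (coeff n) * (Gamma \<sigma> * c n powr (- \<sigma>))) \<le> B * (1 / real n ^ 2)" if n: "n \<ge> 1" for n
    proof -
      have "norm (coeff n) \<le> M * (2 * real n) ^ (k + 1)"
        using M(1) n by (intro order_trans[OF M(2)] mult_left_mono power_mono) auto
      also have "\<dots> = M * 2 ^ (k + 1) * real n powr real (k + 1)"
        using n powr_realpow[of "real n" "k + 1"] by (simp only: power_mult_distrib mult.assoc)
      finally have 1: "norm (coeff n) \<le> M * 2 ^ (k + 1) * real n powr real (k + 1)" .
      have 2: "c n powr (- \<sigma>) = (2 * pi / real_of_int q) powr (- \<sigma>) * real n powr (- \<sigma>)"
        using q_pos by (simp add: c_def powr_mult[symmetric])
      have "norm (coeff n) * (Gamma \<sigma> * c n powr (- \<sigma>)) \<le>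
          M * 2 ^ (k + 1) * real n powr real (k + 1) * (Gamma \<sigma> * c n powr (- \<sigma>))"
        using 1 G0 by (intro mult_right_mono) auto
      also have "\<dots> = B * real n powr (real (k + 1) - \<sigma>)"
        unfolding 2 B_def by (simp add: powr_diff powr_minus field_simps)
      also have "\<dots> \<le> B * real n powr (- 2)"
        using n \<sigma> M(1) G0 unfolding B_def by (intro mult_left_mono powr_mono) auto
      also have "real n powr (- 2) = 1 / real n ^ 2"
        using n by (simp add: powr_minus powr_numeral inverse_eq_divide)
      finally show ?thesis using G0 by simp
    qed
  qed
  have AE: "AE u in lborel. summable (\<lambda>n. norm (a n * E n u))"
  proof (rule AE_I2)
    fix u :: real
    have "((\<lambda>n. coeff n * e_fun (of_nat n * pt (complex_of_real u))) has_sum g (pt (complex_of_real u))) UNIV"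
      by (intro g_has_sum Im_pt_pos) (simp add: strip_def)
    then have "(\<lambda>n. norm (coeff n * e_fun (of_nat n * pt (complex_of_real u)))) summable_on UNIV"
      by (rule summable_on_iff_abs_summable_on_complex[THEN iffD1, OF has_sum_imp_summable])
    then have "summable (\<lambda>n. norm (coeff n * e_fun (of_nat n * pt (complex_of_real u))))"
      by (rule summable_on_UNIV_nonneg_real_iff[THEN iffD1, rotated]) simp
    then have "summable (\<lambda>n. norm (exp (expo s * complex_of_real u)) * norm (coeff n * e_fun (of_nat n * pt (complex_of_real u))))"
      by (rule summable_mult)
    moreover have "norm (exp (expo s * complex_of_real u)) * norm (coeff n * e_fun (of_nat n * pt (complex_of_real u))) = norm (a n * E n u)" for n
      by (simp add: norm_mult norm_a E_def norm_e_fun Im_pt c_def)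
    ultimately show "summable (\<lambda>n. norm (a n * E n u))" by (simp only:)
  qed
  have suminf: "(\<Sum>n. a n * E n u) = G (complex_of_real u) * exp ((s - 1 / 2) * complex_of_real u)" for u
    using G_series[of s u] by (simp add: a_def E_def c_def sums_iff)
  have "(\<lambda>n. LINT u|lborel. a n * E n u) sums (LINT u|lborel. (\<Sum>n. a n * E n u))"
    by (rule sums_integral[OF int AE]) (simp only: nval summ)
  then have sm: "(\<lambda>n. a n * (Gamma (expo s) * complex_of_real (c n) powr (- expo s))) sums mellin G (s - 1 / 2)"
    by (simp only: val suminf mellin_def)
  define R where "R = rGamma (expo s) * of_real (2 * pi / real_of_int q) powr expo s"
  have summand: "a n * (Gamma (expo s) * complex_of_real (c n) powr (- expo s)) * R =
      b n * e_fun (of_nat n * of_real (of_int p / of_int q)) * of_nat n powr (- s)" for n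
  proof (cases "n = 0")
    case True then show ?thesis by (simp add: a0)
  next
    case False
    define d where "d = complex_of_real (2 * pi / real_of_int q)"
    have d0: "d \<noteq> 0" using q_pos by (simp add: d_def)
    have "complex_of_real (c n) = d * of_nat n" by (simp add: c_def d_def)
    moreover have "(d * of_nat n) powr (- expo s) = d powr (- expo s) * of_nat n powr (- expo s)"
      by (rule powr_times_real) (use q_pos in \<open>auto simp: d_def\<close>)
    ultimately have "complex_of_real (c n) powr (- expo s) * d powr expo s = of_nat n powr (- expo s)"
      using d0 by (simp add: powr_minus)
    moreover have "Gamma (expo s) * rGamma (expo s) = 1"
    proof -
      have "expo s \<notin> \<int>\<^sub>\<le>\<^sub>0" using \<sigma>0 by (auto elim!: nonpos_Ints_cases)
      then show ?thesis by (simp add: Gamma_def rGamma_eq_zero_iff)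
    qed
    moreover have "of_nat n powr (- expo s) * of_real (real n powr (real k / 2 - 1 / 4)) = complex_of_nat n powr (- s)"
    proof -
      have "complex_of_real (real n powr (real k / 2 - 1 / 4)) = of_nat n powr of_real (real k / 2 - 1 / 4)"
        by (simp add: powr_of_real[symmetric])
      then show ?thesis
        by (simp only: powr_add[symmetric]) (simp add: expo_def)
    qed
    moreover have "a n * (Gamma (expo s) * complex_of_real (c n) powr (- expo s)) * R =
       b n * e_fun (of_nat n * of_real (of_int p / of_int q)) * (Gamma (expo s) * rGamma (expo s)) *
       ((complex_of_real (c n) powr (- expo s) * d powr expo s) * of_real (real n powr (real k / 2 - 1 / 4)))"
      using False by (simp add: a_def coeff_def R_def d_def mult_ac)
    ultimately show ?thesis by simp
  qed
  have sms: "(\<lambda>n. b n * e_fun (of_nat n * of_real (of_int p / of_int q)) * of_nat n powr (- s)) sums L s"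
    using sums_mult2[OF sm, of R] unfolding summand by (simp add: L_def R_def mult.assoc)
  \<comment> \<open>\<open>has_sum\<close> is unconditional, so the convergent series also needs
    absolute summability; each term is dominated by the integral of the norm computed above.\<close>
  have S1: "summable (\<lambda>n. norm (coeff n) * (Gamma \<sigma> * c n powr (- \<sigma>)) * norm R)"
    by (rule summable_mult2[OF summ])
  have S2: "norm (b n * e_fun (of_nat n * of_real (of_int p / of_int q)) * of_nat n powr (- s)) \<le>
      norm (coeff n) * (Gamma \<sigma> * c n powr (- \<sigma>)) * norm R" for n
  proof -
    have "norm (LINT u|lborel. a n * E n u) \<le> norm (coeff n) * (Gamma \<sigma> * c n powr (- \<sigma>))"
      unfolding nval[symmetric] by (rule integral_norm_bound)
    then show ?thesis
      unfolding summand[symmetric] val norm_mult[of _ R] by (rule mult_right_mono) simp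
  qed
  have "summable (\<lambda>n. norm (b n * e_fun (of_nat n * of_real (of_int p / of_int q)) * of_nat n powr (- s)))"
    by (rule summable_comparison_test'[OF S1, of 0]) (simp only: real_norm_def abs_norm_cancel S2)
  from norm_summable_imp_has_sum[OF this sms] show ?thesis
    by (rule has_sum_cong_neutral[THEN iffD1, rotated 3]) auto
qed

lemma is_twisted_L: "is_twisted_L b (of_int p / of_int q) L"
  unfolding is_twisted_L_def using L_entire L_series by blast

lemma twisted_L_eq: "twisted_L b (of_int p / of_int q) = L"
  unfolding twisted_L_def
  using is_twisted_L is_twisted_L_unique by (intro the_equality) blast+

text \<open>The direction of transfer that matters: zeros of the real transform give zeros of
  \<open>L\<close>, so finiteness for \<open>L\<close> implies finiteness for the transform.\<close>

lemma L_critical_line: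
  fixes t :: real
  assumes "mellin h (\<i> * complex_of_real t) = 0"
  shows "L (1 / 2 + \<i> * complex_of_real t) = 0"
proof -
  have "mellin h z = mellin G z / csqrt \<omega>" for z
    by (simp add: mellin_def h_def)
  with assms have "mellin G (\<i> * complex_of_real t) = 0" using \<omega>_nz by simp
  then show ?thesis by (simp add: L_def)
qed

subsection \<open>Zeros on the critical line\<close>

text \<open>The point \<open>pt (\<i> * \<theta>)\<close> runs into the cusp \<open>(p - 1) / q\<close> as \<open>\<theta>\<close> tends to \<open>\<pi> / 2\<close>.\<close>

lemma cusp_bounded:
  obtains C \<delta> where "\<delta> > 0"
    and "\<And>\<theta>. 0 \<le> \<theta> \<Longrightarrow> \<theta> < pi / 2 \<Longrightarrow> cos \<theta> < \<delta> \<Longrightarrow> norm (G (\<i> * complex_of_real \<theta>)) \<le> C"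
proof -
  \<comment> \<open>The cusp \<open>(p - 1) / q\<close> is put in lowest terms \<open>a / c\<close>,
    so that the matrix \<open>A\<close> below, with bottom row \<open>(- c, a)\<close>, sends it to
    infinity.\<close>
  define d where "d = gcd (p - 1) q"
  define a where "a = (p - 1) div d"
  define c where "c = q div d"
  have d: "d > 0" "d dvd p - 1" "d dvd q" using q_pos by (auto simp: d_def intro: gcd_pos_int[THEN iffD2])
  have c0: "c > 0" using d q_pos by (simp add: c_def pos_imp_zdiv_pos_iff zdvd_imp_le)
  have "coprime a c" unfolding a_def c_def d_def using q_pos by (intro div_gcd_coprime) auto
  then obtain u v where uv: "u * a + v * c = 1"
    using bezout_int[of a c] by auto
  have ac: "of_int a * real_of_int q = of_int c * (of_int p - 1)"
  proof -
    have "a * d = p - 1" "c * d = q" using d by (simp_all add: a_def c_def)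
    then have "a * q = c * (p - 1)" by (metis mult.assoc mult.commute)
    then show ?thesis by (metis of_int_1 of_int_diff of_int_mult)
  qed
  define A where "A = mat2 u v (- c) a"
  have A: "A \<in> SL2Z" using uv by (simp add: A_def SL2Z_iff algebra_simps)
  obtain C Y where C: "C \<ge> 0" "\<And>z. Im z \<ge> Y \<Longrightarrow> norm (slash (adj2 A) z) \<le> C * exp (- pi / (2 * real N) * Im z)"
    using slash_exp_decay[OF SL2Z_adj2[OF A]] by blast
  \<comment> \<open>With \<open>\<rho> = q / c\<close>, the squared automorphy factor is at most
    \<open>2 * (cos \<theta>)^2 / \<rho>^2\<close>. Dividing the height
    \<open>cos \<theta> / q\<close> by this gives \<open>\<mu> / cos \<theta>\<close>, a lower bound
    for the height of the image.\<close>
  define \<mu> where "\<mu> = real_of_int q / (2 * (real_of_int c)\<^sup>2)"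
  define \<rho> where "\<rho> = real_of_int q / real_of_int c"
  have \<mu>0: "\<mu> > 0" and \<rho>0: "\<rho> > 0" using q_pos c0 by (simp_all add: \<mu>_def \<rho>_def)
  \<comment> \<open>Exponential decay in \<open>X = 1 / cos \<theta>\<close> outweighs the power of
    \<open>X\<close> contributed by the automorphy factor.\<close>
  obtain K where K: "\<And>x. x \<ge> 0 \<Longrightarrow> (1 + x) ^ (k + 1) * exp (- (pi / (2 * real N) * \<mu>) * x) \<le> K"
    using poly_times_exp_bounded[of "pi / (2 * real N) * \<mu>" "k + 1"] \<mu>0 N_pos by auto
  show thesis
  proof (rule that[of "\<mu> / max Y 1" "C * (1 + \<rho>) ^ (k + 1) * K"])
    show "\<mu> / max Y 1 > 0" using \<mu>0 by simp
    fix \<theta> assume \<theta>: "0 \<le> \<theta>" "\<theta> < pi / 2" "cos \<theta> < \<mu> / max Y 1"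
    define X where "X = 1 / cos \<theta>"
    have cos0: "cos \<theta> > 0" using \<theta> by (intro cos_gt_zero_pi) auto
    have X0: "X > 0" using cos0 by (simp add: X_def)
    have strip: "\<i> * complex_of_real \<theta> \<in> strip" using \<theta> by (simp add: strip_def)
    define z where "z = pt (\<i> * complex_of_real \<theta>)"
    have Imz: "Im z > 0" unfolding z_def using Im_pt_pos[OF strip] .
    have Imz': "Im z = cos \<theta> / real_of_int q" by (simp add: z_def Im_pt)
    define r where "r = norm (auto_denom A z)"
    have Rez: "Re z = (real_of_int p - sin \<theta>) / real_of_int q"
      by (simp add: z_def pt_def Re_divide Im_exp power2_eq_square diff_divide_distrib)
    have Re: "Re (auto_denom A z) = - (1 - sin \<theta>) / \<rho>"
    proof -
      have "Re (auto_denom A z) = real_of_int a - real_of_int c * Re z"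
        by (simp add: auto_denom_def A_def)
      also have "real_of_int a = real_of_int c * (real_of_int p - 1) / real_of_int q"
        using ac q_pos by (simp add: field_simps)
      finally have "Re (auto_denom A z) = real_of_int c * (real_of_int p - 1) / real_of_int q -
          real_of_int c * ((real_of_int p - sin \<theta>) / real_of_int q)"
        unfolding Rez .
      also have "\<dots> = - (1 - sin \<theta>) / \<rho>"
        using q_pos c0 by (simp add: \<rho>_def field_simps)
      finally show ?thesis .
    qed
    have Im: "Im (auto_denom A z) = - cos \<theta> / \<rho>"
      using q_pos c0 by (simp add: auto_denom_def A_def Imz' \<rho>_def)
    have "r\<^sup>2 = ((1 - sin \<theta>)\<^sup>2 + (cos \<theta>)\<^sup>2) / \<rho>\<^sup>2"
      unfolding r_def cmod_power2 Re Im by (simp add: power_divide add_divide_distrib power2_commute)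
    moreover have "(1 - sin \<theta>)\<^sup>2 \<le> (cos \<theta>)\<^sup>2"
    proof -
      have "0 \<le> sin \<theta>" using \<theta> by (intro sin_ge_zero) auto
      then have "(1 - sin \<theta>) * (1 - sin \<theta>) \<le> (1 - sin \<theta>) * (1 + sin \<theta>)"
        by (intro mult_left_mono) auto
      moreover have "(cos \<theta>)\<^sup>2 = (1 - sin \<theta>) * (1 + sin \<theta>)"
        by (simp add: cos_squared_eq power2_eq_square algebra_simps)
      ultimately show ?thesis by (simp only: power2_eq_square)
    qed
    ultimately have r2: "r\<^sup>2 \<le> 2 * (cos \<theta>)\<^sup>2 / \<rho>\<^sup>2"
      using \<rho>0 by (simp add: divide_right_mono)
    have r_pos: "r > 0" unfolding r_def using auto_denom_nz[OF A Imz] by simp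
    have "\<mu> * X \<le> Im (moebius A z)"
    proof -
      have "\<mu> * X = (cos \<theta> / real_of_int q) / (2 * (cos \<theta>)\<^sup>2 / \<rho>\<^sup>2)"
        using q_pos c0 cos0 by (simp add: \<mu>_def X_def \<rho>_def power2_eq_square field_simps)
      also have "\<dots> \<le> (cos \<theta> / real_of_int q) / r\<^sup>2"
        using r2 r_pos cos0 q_pos \<rho>0 by (intro divide_left_mono mult_pos_pos divide_pos_pos) auto
      finally show ?thesis by (simp add: Im_moebius[OF A Imz] Imz' r_def)
    qed
    moreover have "Y \<le> \<mu> * X"
    proof -
      have "cos \<theta> * max Y 1 < \<mu>"
        using \<theta>(3) by (simp add: pos_less_divide_eq)
      moreover have "cos \<theta> * Y \<le> cos \<theta> * max Y 1" using cos0 by (intro mult_left_mono) auto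
      ultimately have "cos \<theta> * Y \<le> \<mu>" by linarith
      then show ?thesis using cos0 by (simp add: X_def pos_le_divide_eq mult.commute)
    qed
    ultimately have "norm (slash (adj2 A) (moebius A z)) \<le> C * exp (- pi / (2 * real N) * Im (moebius A z))"
      by (intro C(2)) simp
    also have "\<dots> \<le> C * exp (- (pi / (2 * real N) * \<mu>) * X)"
    proof -
      have "pi / (2 * real N) * (\<mu> * X) \<le> pi / (2 * real N) * Im (moebius A z)"
        using \<open>\<mu> * X \<le> Im (moebius A z)\<close> by (intro mult_left_mono) auto
      then show ?thesis using C(1) by (intro mult_left_mono) (auto simp: mult.assoc)
    qed
    finally have 1: "norm (slash (adj2 A) (moebius A z)) \<le> C * exp (- (pi / (2 * real N) * \<mu>) * X)" .
    have "cos \<theta> / \<rho> \<le> r"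
      using abs_Im_le_cmod[of "auto_denom A z"] cos0 \<rho>0 unfolding Im r_def by simp
    then have "1 / r \<le> \<rho> * X"
      using cos0 \<rho>0 r_pos by (simp add: X_def field_simps)
    moreover have "\<rho> * X \<le> (1 + \<rho>) * (1 + X)"
      using \<rho>0 X0 by (simp add: algebra_simps)
    ultimately have "sqrt (1 / r) ^ (2 * k + 1) \<le> ((1 + \<rho>) * (1 + X)) ^ (k + 1)"
      using r_pos \<rho>0 X0 by (intro sqrt_power_le) (auto simp: algebra_simps)
    then have 2: "1 / sqrt r ^ (2 * k + 1) \<le> (1 + \<rho>) ^ (k + 1) * (1 + X) ^ (k + 1)"
      by (simp only: real_sqrt_divide power_divide power_mult_distrib real_sqrt_one power_one)
    have "norm (G (\<i> * complex_of_real \<theta>)) = norm (g z)"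
      by (simp add: G_def z_def norm_mult)
    also have "\<dots> = norm (slash (adj2 A) (moebius A z)) * (1 / sqrt r ^ (2 * k + 1))"
      by (simp only: g_eq_slash[OF A Imz] norm_wt r_def) simp
    also have "\<dots> \<le> (C * exp (- (pi / (2 * real N) * \<mu>) * X)) * ((1 + \<rho>) ^ (k + 1) * (1 + X) ^ (k + 1))"
      using 1 2 C(1) r_pos by (intro mult_mono) auto
    also have "\<dots> = C * (1 + \<rho>) ^ (k + 1) * ((1 + X) ^ (k + 1) * exp (- (pi / (2 * real N) * \<mu>) * X))"
      by (simp only: mult_ac)
    also have "\<dots> \<le> C * (1 + \<rho>) ^ (k + 1) * K"
      using K[of X] X0 C(1) \<rho>0 by (intro mult_left_mono) auto
    finally show "norm (G (\<i> * complex_of_real \<theta>)) \<le> C * (1 + \<rho>) ^ (k + 1) * K" .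
  qed
qed

text \<open>The sequence consists of the translates by \<open>- m\<close> of \<open>\<Gamma>\<^sub>0(N)\<close>-equivalent points that tend to 0.\<close>

lemma G_unbounded:
  obtains w where "\<And>n. Im (w n) < pi / 2" and "(\<lambda>n. Im (w n)) \<longlonglongrightarrow> pi / 2"
    and "filterlim (\<lambda>n. norm (G (w n))) at_top sequentially"
proof -
  obtain z0 where z0: "Im z0 > 0" "g z0 \<noteq> 0" using g_nonzero[OF b1] by blast
  \<comment> \<open>Lower unipotent matrices: the images of \<open>z0\<close> tend to 0, while the
    automorphy factor, hence \<open>\<bar>g\<bar>\<close>, grows without bound.\<close>
  define A where "A = (\<lambda>n::nat. mat2 1 0 (int N * int n) 1)"
  have A: "A n \<in> Gamma0 N" for n by (simp add: A_def Gamma0_def SL2Z_iff)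
  define j where "j = (\<lambda>n. auto_denom (A n) z0)"
  have j: "j n = of_nat N * of_nat n * z0 + 1" for n by (simp add: j_def A_def auto_denom_def)
  have j_top: "filterlim (\<lambda>n. norm (j n)) at_top sequentially"
  proof (rule filterlim_at_top_mono)
    show "filterlim (\<lambda>n. (real N * Im z0) * real n) at_top sequentially"
      using N_pos z0 by (intro filterlim_tendsto_pos_mult_at_top[OF tendsto_const _ filterlim_real_sequentially]) simp
    show "\<forall>\<^sub>F n in sequentially. (real N * Im z0) * real n \<le> norm (j n)"
    proof (intro always_eventually allI)
      fix n
      have "(real N * Im z0) * real n = Im (j n)" by (simp add: j mult_ac)
      also have "\<dots> \<le> norm (j n)" using abs_Im_le_cmod[of "j n"] by linarith
      finally show "(real N * Im z0) * real n \<le> norm (j n)" .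
    qed
  qed
  have g_top: "filterlim (\<lambda>n. norm (g (moebius (A n) z0))) at_top sequentially"
  proof -
    have "filterlim (\<lambda>n. sqrt (norm (j n)) ^ (2 * k + 1)) at_top sequentially"
      by (intro filterlim_pow_at_top filterlim_compose[OF sqrt_at_top j_top]) simp
    then have "filterlim (\<lambda>n. norm (g z0) * sqrt (norm (j n)) ^ (2 * k + 1)) at_top sequentially"
      using z0 by (intro filterlim_tendsto_pos_mult_at_top[OF tendsto_const]) auto
    then show ?thesis
      by (simp only: norm_transform[OF A z0(1)] norm_wt j_def mult.commute)
  qed
  \<comment> \<open>The edge \<open>Im w = pi / 2\<close> is mapped by \<open>pt\<close> to the
    reals \<open>(p - exp u) / q\<close>, those to the left of \<open>p / q\<close>. The shift makes
    the limit point \<open>- m\<close> one of them: its distance \<open>x\<close> from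
    \<open>p / q\<close> is at least 1.\<close>
  define m where "m = \<lceil>1 - real_of_int p / real_of_int q\<rceil>"
  define x where "x = real_of_int m + real_of_int p / real_of_int q"
  have x: "x \<ge> 1" unfolding x_def m_def by linarith
  \<comment> \<open>The solution for \<open>exp w\<close> of
    \<open>pt w = moebius (A n) z0 - m\<close>. Its limit \<open>\<i> * q * x\<close> has logarithm
    \<open>ln (q * x) + \<i> * pi / 2\<close>, so \<open>Re w\<close> converges and the exponential
    factor in \<open>G\<close> cannot offset the growth of \<open>g\<close>.\<close>
  define y where "y = (\<lambda>n. \<i> * of_int q * (of_real x - moebius (A n) z0))"
  define w where "w = (\<lambda>n. Ln (y n))"
  have moeb: "Im (moebius (A n) z0) > 0" for n
    using Im_moebius_pos[OF Gamma0_SL2Z[OF A] z0(1)] .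
  have Re_y: "Re (y n) > 0" for n
    using moeb[of n] q_pos by (simp add: y_def)
  then have y_nz: "y n \<noteq> 0" for n by (metis less_irrefl zero_complex.simps(1))
  have pt_w: "pt (w n) = moebius (A n) z0 + of_int (- m)" for n
    using y_nz[of n] q_pos by (simp add: pt_def w_def) (simp add: y_def x_def field_simps)
  have m0: "(\<lambda>n. moebius (A n) z0) \<longlonglongrightarrow> 0"
  proof -
    have "(\<lambda>n. z0 / j n) \<longlonglongrightarrow> 0"
      using j_top by (intro tendsto_divide_0[OF tendsto_const] filterlim_norm_at_top_imp_at_infinity)
    then show ?thesis by (simp add: moebius_def A_def j_def)
  qed
  have y_lim: "y \<longlonglongrightarrow> \<i> * of_int q * (of_real x - 0)"
    unfolding y_def by (intro tendsto_intros m0)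
  have "w \<longlonglongrightarrow> Ln (\<i> * of_int q * (of_real x - 0))"
    unfolding w_def by (rule tendsto_Ln[OF y_lim]) (use x q_pos in \<open>auto simp: complex_nonpos_Reals_iff\<close>)
  also have "Ln (\<i> * of_int q * (of_real x - 0)) = of_real (ln (q * x)) + \<i> * of_real (pi / 2)"
  proof (rule Ln_unique)
    have "exp (complex_of_real (ln (of_int q * x)) + \<i> * complex_of_real (pi / 2)) = complex_of_real (of_int q * x) * \<i>"
      using x q_pos by (simp only: exp_add cis_conv_exp[symmetric] cis_pi_half exp_of_real) simp
    then show "exp (complex_of_real (ln (of_int q * x)) + \<i> * complex_of_real (pi / 2)) = \<i> * of_int q * (of_real x - 0)"
      by simp
  qed auto
  finally have w_lim: "w \<longlonglongrightarrow> of_real (ln (q * x)) + \<i> * of_real (pi / 2)" .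
  show thesis
  proof (rule that[of w])
    show "Im (w n) < pi / 2" for n
      using Re_Ln_pos_lt[OF y_nz[of n]] Re_y[of n] by (simp add: w_def)
    show "(\<lambda>n. Im (w n)) \<longlonglongrightarrow> pi / 2"
      using tendsto_Im[OF w_lim] by simp
    have "norm (G (w n)) = exp (real (2 * k + 1) / 4 * Re (w n)) * norm (g (moebius (A n) z0))" for n
      unfolding G_def pt_w g_periodic[OF moeb] by (simp add: norm_mult)
    moreover have "(\<lambda>n. exp (real (2 * k + 1) / 4 * Re (w n))) \<longlonglongrightarrow> exp (real (2 * k + 1) / 4 * ln (q * x))"
      using tendsto_Re[OF w_lim] by (intro tendsto_intros) simp
    ultimately show "filterlim (\<lambda>n. norm (G (w n))) at_top sequentially"
      by (simp only:) (rule filterlim_tendsto_pos_mult_at_top[OF _ _ g_top], auto)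
  qed
qed

lemma infinite_zeros: "infinite {s. Re s = 1 / 2 \<and> L s = 0}"
proof
  assume fin: "finite {s. Re s = 1 / 2 \<and> L s = 0}"
  define H where "H = (\<lambda>t::real. Re (mellin h (\<i> * complex_of_real t)))"
  have "finite {t. H t = 0}" (is "finite ?Z")
  proof (rule finite_subset)
    show "{t. H t = 0} \<subseteq> Im ` {s. Re s = 1 / 2 \<and> L s = 0}"
    proof
      fix t assume "t \<in> {t. H t = 0}"
      then have "mellin h (\<i> * complex_of_real t) = 0"
        using mellin_h_real[of t] by (simp add: H_def complex_eq_iff complex_is_Real_iff)
      from L_critical_line[OF this] show "t \<in> Im ` {s. Re s = 1 / 2 \<and> L s = 0}"
        by (intro image_eqI[of _ _ "1 / 2 + \<i> * complex_of_real t"]) auto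
    qed
  qed (use fin in simp)
  from finite_imp_bounded[OF this] obtain T0 where "\<forall>t\<in>?Z. \<bar>t\<bar> \<le> T0"
    unfolding bounded_real by blast
  then have T0: "t \<le> T0" if "H t = 0" for t using that by force
  define T where "T = T0 + 1"
  have nz: "H t \<noteq> 0" if "t \<ge> T" for t using T0[of t] that by (auto simp: T_def)
  have H_cont: "continuous_on {T..} H"
    unfolding H_def
    by (intro continuous_intros continuous_on_compose2[OF holomorphic_on_imp_continuous_on[OF mellin_entire[OF h_hol h_rapid_decay]]]) auto
  have "connected (H ` {T..})"
    using H_cont by (rule connected_continuous_image) simp
  note interval = connectedD_interval[OF this]
  \<comment> \<open>Opposite signs beyond \<open>T\<close> would force a zero there, since the image
    of the ray under \<open>H\<close> is connected.\<close>
  have sign: "(\<forall>t\<ge>T. H t \<ge> 0) \<or> (\<forall>t\<ge>T. H t \<le> 0)"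
  proof (rule ccontr)
    assume "\<not> ?thesis"
    then obtain t1 t2 where t: "t1 \<ge> T" "t2 \<ge> T" "H t1 < 0" "H t2 > 0" by (auto simp: not_le)
    have "H t1 \<in> H ` {T..}" "H t2 \<in> H ` {T..}" using t by blast+
    then have "0 \<in> H ` {T..}" by (rule interval) (use t in simp_all)
    then obtain t where "t \<ge> T" "H t = 0" by (metis atLeast_iff imageE)
    then show False using nz by blast
  qed
  \<comment> \<open>If \<open>H\<close> is eventually nonpositive, the bound is applied to
    \<open>- h\<close>, which has the same modulus.\<close>
  have neg: "mellin (\<lambda>w. - h w) z = - mellin h z" for z by (simp add: mellin_def)
  have "\<exists>C. \<forall>w. 1 \<le> Im w \<longrightarrow> Im w < pi / 2 \<longrightarrow> norm (G w) \<le> norm (G (\<i> * Im w)) + C"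
    using sign
  proof
    assume "\<forall>t\<ge>T. H t \<ge> 0"
    then have "Re (mellin h (\<i> * complex_of_real t)) \<ge> 0" if "t \<ge> T" for t
      using that by (simp add: H_def)
    from strip_bound_of_nonneg[OF h_hol h_rapid_decay mellin_h_real this]
    show ?thesis by (simp only: norm_h)
  next
    assume "\<forall>t\<ge>T. H t \<le> 0"
    then have nonneg: "Re (mellin (\<lambda>w. - h w) (\<i> * complex_of_real t)) \<ge> 0" if "t \<ge> T" for t
      using that by (simp add: H_def neg)
    have real: "mellin (\<lambda>w. - h w) (\<i> * complex_of_real t) \<in> \<real>" for t
      unfolding neg using mellin_h_real by simp
    have "rapid_decay (\<lambda>w. - h w)" using h_rapid_decay by (simp add: rapid_decay_def)
    from strip_bound_of_nonneg[OF holomorphic_on_minus[OF h_hol] this real nonneg]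
    show ?thesis by (simp only: norm_minus_cancel norm_h)
  qed
  then obtain C where C: "\<And>w. 1 \<le> Im w \<Longrightarrow> Im w < pi / 2 \<Longrightarrow> norm (G w) \<le> norm (G (\<i> * Im w)) + C"
    by blast
  obtain C' \<delta> where C': "\<delta> > 0"
      "\<And>\<theta>. 0 \<le> \<theta> \<Longrightarrow> \<theta> < pi / 2 \<Longrightarrow> cos \<theta> < \<delta> \<Longrightarrow> norm (G (\<i> * complex_of_real \<theta>)) \<le> C'"
    using cusp_bounded by blast
  obtain w where w: "\<And>n::nat. Im (w n) < pi / 2" "(\<lambda>n. Im (w n)) \<longlonglongrightarrow> pi / 2"
    "filterlim (\<lambda>n. norm (G (w n))) at_top sequentially"
    using G_unbounded by blast
  have "(\<lambda>n. cos (Im (w n))) \<longlonglongrightarrow> cos (pi / 2)"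
    by (intro tendsto_intros w)
  then have "eventually (\<lambda>n. cos (Im (w n)) < \<delta>) sequentially"
    by (rule order_tendstoD) (use C' in simp)
  moreover have "eventually (\<lambda>n. Im (w n) > 1) sequentially"
    using w(2) by (rule order_tendstoD) (use pi_gt3 in simp)
  moreover have "eventually (\<lambda>n. norm (G (w n)) > C' + C) sequentially"
    using w(3) by (simp add: filterlim_at_top_dense)
  ultimately have "eventually (\<lambda>n. False) sequentially"
  proof eventually_elim
    case (elim n)
    have "norm (G (w n)) \<le> norm (G (\<i> * Im (w n))) + C"
      using elim w(1) by (intro C) auto
    moreover have "norm (G (\<i> * Im (w n))) \<le> C'"
      using elim w(1) by (intro C') auto
    ultimately show ?case using elim by simp
  qed
  then show False by simp
qed

end

theorem theorem1p2:
  fixes k N :: nat and p q :: int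
    and g :: "complex \<Rightarrow> complex" and b :: "nat \<Rightarrow> complex"
  assumes "k > 0" and "N > 0" and "4 dvd N"
    and "q > 0" and "coprime p q"
    and "equiv_infinity N (of_int p / of_int q)"
    and "[p\<^sup>2 = 1] (mod q)"
    and "g \<in> half_integral_cusp_forms k N"
    and "\<forall>z\<in>upper_half_plane.
           ((\<lambda>n. b n * of_real (real n powr (real k / 2 - 1 / 4)) * e_fun (of_nat n * z))
              has_sum g z) {1..}"
    and "b 1 \<noteq> 0"
    and "\<forall>j\<ge>1. b j \<in> \<real>"
  shows "infinite {s. Re s = 1 / 2 \<and> twisted_L b (of_int p / of_int q) s = 0}"
proof -
  obtain A where A: "A \<in> Gamma0 N" "A $ 2 $ 1 \<noteq> 0"
      "real_of_int p / of_int q = of_int (A $ 1 $ 1) / of_int (A $ 2 $ 1)"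
    using \<open>equiv_infinity N (of_int p / of_int q)\<close> unfolding equiv_infinity_def by blast
  have "real_of_int (p * A $ 2 $ 1) = real_of_int (A $ 1 $ 1 * q)"
    using A(2,3) \<open>q > 0\<close> by (simp add: field_simps)
  then have "p * A $ 2 $ 1 = A $ 1 $ 1 * q" by (simp only: of_int_eq_iff)
  \<comment> \<open>The first column of \<open>A\<close> is coprime, so equality of the fractions
    makes its lower entry a divisor of \<open>q\<close>. Equivalence to infinity thus enters as
    \<open>N dvd q\<close>.\<close>
  then have "A $ 2 $ 1 dvd A $ 1 $ 1 * q" by (metis dvd_triv_right)
  moreover have "coprime (A $ 2 $ 1) (A $ 1 $ 1)"
  proof (rule coprimeI)
    fix l assume "l dvd A $ 2 $ 1" "l dvd A $ 1 $ 1"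
    then have "l dvd A $ 1 $ 1 * A $ 2 $ 2 - A $ 1 $ 2 * A $ 2 $ 1" by simp
    then show "is_unit l" using A(1) by (simp add: Gamma0_def SL2Z_iff)
  qed
  ultimately have "A $ 2 $ 1 dvd q"
    by (simp add: coprime_dvd_mult_right_iff)
  moreover have "int N dvd A $ 2 $ 1" using A(1) by (simp add: Gamma0_def)
  ultimately have "int N dvd q" by (rule dvd_trans[rotated])
  \<comment> \<open>The quotient serves as the upper right entry of the matrix
    \<open>\<gamma>\<close>, whose determinant is then 1.\<close>
  moreover obtain \<beta> where "p\<^sup>2 - 1 = q * \<beta>"
    using \<open>[p\<^sup>2 = 1] (mod q)\<close> by (auto simp: cong_iff_dvd_diff)
  then have "p * p - \<beta> * q = 1" by (simp add: power2_eq_square algebra_simps)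
  ultimately interpret twisted_form k N g b p q \<beta>
    using assms by unfold_locales (auto simp: upper_half_plane_def)
  show ?thesis unfolding twisted_L_eq by (rule infinite_zeros)
qed

end
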